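(* Let $H$ and $F$ be two non-trivial connected graphs that are relatively prime with respect to the Cartesian product, with $|V(H)|=n$ and $|V(F)|=m$. 1. If $n$ is even and $m\geq n-1$, then $D_\mathcal{R}(H\square F)\leq m+1$. 2. If $n$ is odd, $m$ is even and $m\geq 2n-2$, then $D_\mathcal{R}(H\square F)\leq m+1$. 3. If $n$ and $m$ are odd and $m\geq 2n-1$, then $D_\mathcal{G}(H\square F)\leq m+1$.
   Context: All graphs are finite and simple. $H\square F$ is the Cartesian product. Two graphs are relatively prime if they have no common non-trivial (i.e. not $K_1$) factor with respect to the Cartesian product. A coloring $c:V(X)\to\{1,\dots,d\}$ of a graph $X$ is distinguishing if the only automorphism $\sigma$ of $X$ with $c\circ\sigma=c$ is the identity. The distinguishing game on a graph $X$ with $d$ colors: two players, Gentle and Rascal, alternately choose an uncolored vertex of $X$ and color it with one of the $d$ colors; when all vertices are colored, Gentle wins if the coloring is distinguishing, otherwise Rascal wins. $D_\mathcal{G}(X)$ (resp. $D_\mathcal{R}(X)$) is the least $d$ such that Gentle has a winning strategy with $d$ colors when Gentle (resp. Rascal) makes the first move; it is $\infty$ if no such $d$ exists. *)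

theory Defs
  imports
    "Graph_Theory.Pair_Digraph"
    "Graph_Theory.Digraph_Component"
    "Graph_Theory.Digraph_Isomorphism"
    "HOL-Library.Extended_Nat"
begin

text \<open>Finite simple graphs are represented by \<^locale>\<open>pair_graph\<close>: finite, loop-free, with a
  symmetric set of arcs, so that an edge between u and v is the pair of arcs (u,v) and (v,u).\<close>

definition cartesian_product ::
    "'a pair_pre_digraph \<Rightarrow> 'b pair_pre_digraph \<Rightarrow> ('a \<times> 'b) pair_pre_digraph"  (infixr "\<box>" 70)
where
  "H \<box> F = \<lparr> pverts = pverts H \<times> pverts F,
    parcs = {((u, x), (v, y)) | u x v y.
      u \<in> pverts H \<and> v \<in> pverts H \<and> x \<in> pverts F \<and> y \<in> pverts F \<and>
      ((u, v) \<in> parcs H \<and> x = y \<or> u = v \<and> (x, y) \<in> parcs F)} \<rparr>"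

text \<open>Graphs have at least one vertex, so a non-trivial graph (one that is not a single vertex)
  has at least two.\<close>

definition nontrivial :: "'a pair_pre_digraph \<Rightarrow> bool" where
  "nontrivial G \<longleftrightarrow> 2 \<le> card (pverts G)"

text \<open>Every finite graph is isomorphic to one with vertices in \<^typ>\<open>nat\<close>, so it suffices to
  consider factors and cofactors of that type.\<close>

definition cartesian_factor :: "nat pair_pre_digraph \<Rightarrow> 'a pair_pre_digraph \<Rightarrow> bool" where
  "cartesian_factor X G \<longleftrightarrow> pair_graph X \<and>
     (\<exists>Y :: nat pair_pre_digraph. pair_graph Y \<and> digraph_iso (with_proj G) (with_proj (X \<box> Y)))"

definition relatively_prime :: "'a pair_pre_digraph \<Rightarrow> 'b pair_pre_digraph \<Rightarrow> bool" where
  "relatively_prime H F \<longleftrightarrow>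
     \<not> (\<exists>X. nontrivial X \<and> cartesian_factor X H \<and> cartesian_factor X F)"

text \<open>Values of an automorphism outside the vertex set are irrelevant.\<close>

definition automorphism :: "'a pair_pre_digraph \<Rightarrow> ('a \<Rightarrow> 'a) \<Rightarrow> bool" where
  "automorphism G \<sigma> \<longleftrightarrow> bij_betw \<sigma> (pverts G) (pverts G) \<and>
     (\<forall>u\<in>pverts G. \<forall>v\<in>pverts G. (\<sigma> u, \<sigma> v) \<in> parcs G \<longleftrightarrow> (u, v) \<in> parcs G)"

definition distinguishing :: "'a pair_pre_digraph \<Rightarrow> ('a \<Rightarrow> 'c) \<Rightarrow> bool" where
  "distinguishing G c \<longleftrightarrow>
     (\<forall>\<sigma>. automorphism G \<sigma> \<and> (\<forall>v\<in>pverts G. c (\<sigma> v) = c v) \<longrightarrow> (\<forall>v\<in>pverts G. \<sigma> v = v))"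

text \<open>A play is the list of moves made so far, oldest first; the move (v, k) colors the
  vertex v with the color k.\<close>

type_synonym 'a play = "('a \<times> nat) list"

definition legal_play :: "'a pair_pre_digraph \<Rightarrow> nat \<Rightarrow> 'a play \<Rightarrow> bool" where
  "legal_play G d p \<longleftrightarrow> distinct (map fst p) \<and> set p \<subseteq> pverts G \<times> {1..d}"

definition complete_play :: "'a pair_pre_digraph \<Rightarrow> nat \<Rightarrow> 'a play \<Rightarrow> bool" where
  "complete_play G d p \<longleftrightarrow> legal_play G d p \<and> fst ` set p = pverts G"

definition final_coloring :: "'a play \<Rightarrow> 'a \<Rightarrow> nat" where
  "final_coloring p v = the (map_of p v)"

datatype player = Gentle | Rascal

text \<open>The first argument is the player who makes the first move.\<close>

definition gentle_to_move :: "player \<Rightarrow> 'a play \<Rightarrow> bool" where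
  "gentle_to_move first p \<longleftrightarrow> (even (length p) \<longleftrightarrow> first = Gentle)"

definition gentle_strategy ::
    "player \<Rightarrow> 'a pair_pre_digraph \<Rightarrow> nat \<Rightarrow> ('a play \<Rightarrow> 'a \<times> nat) \<Rightarrow> bool" where
  "gentle_strategy first G d s \<longleftrightarrow>
     (\<forall>p. legal_play G d p \<and> \<not> complete_play G d p \<and> gentle_to_move first p
        \<longrightarrow> legal_play G d (p @ [s p]))"

definition follows :: "player \<Rightarrow> ('a play \<Rightarrow> 'a \<times> nat) \<Rightarrow> 'a play \<Rightarrow> bool" where
  "follows first s p \<longleftrightarrow>
     (\<forall>i<length p. gentle_to_move first (take i p) \<longrightarrow> p ! i = s (take i p))"

definition gentle_has_winning_strategy :: "player \<Rightarrow> 'a pair_pre_digraph \<Rightarrow> nat \<Rightarrow> bool" where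
  "gentle_has_winning_strategy first G d \<longleftrightarrow>
     (\<exists>s. gentle_strategy first G d s \<and>
        (\<forall>p. complete_play G d p \<and> follows first s p \<longrightarrow> distinguishing G (final_coloring p)))"

text \<open>The condition that d is positive matters: without colors no play can be completed, and
  every strategy would be winning vacuously. The infimum of the empty set is \<open>\<infinity>\<close>.\<close>

definition game_distinguishing_number :: "player \<Rightarrow> 'a pair_pre_digraph \<Rightarrow> enat" where
  "game_distinguishing_number first G =
     Inf {enat d | d. 1 \<le> d \<and> gentle_has_winning_strategy first G d}"

abbreviation D_G :: "'a pair_pre_digraph \<Rightarrow> enat" where
  "D_G \<equiv> game_distinguishing_number Gentle"

abbreviation D_R :: "'a pair_pre_digraph \<Rightarrow> enat" where
  "D_R \<equiv> game_distinguishing_number Rascal"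

end

theory Submission
  imports Defs
begin

text \<open>Automorphisms. Distances in a Cartesian product of connected graphs are sums of distances in
  the factors, so layers are geodesically convex, and a convex set is a box. An automorphism
  \<open>\<sigma>\<close> of \<open>H \<box> F\<close> gives a second product structure on the same graph; each layer of the first is
  then the product of its intersections with the two kinds of layers of the second. The
  intersection of an H-layer with an image of an F-layer is thus a common factor of H and F, hence
  a point. So \<open>\<sigma> = \<alpha> \<times> \<beta>\<close> for permutations of the vertices of H and F.

  Strategy. For each vertex f of F, Gentle uses a matching of the vertices of H and answers a
  move at (h, f) at the partner of h in the same fibre, with a colour different from the colour of
  (h, f) and such that the sums of the colours of completed fibres are pairwise distinct modulo
  the number of colours; at most m of the m + 1 colours are forbidden. The sums force
  \<open>\<beta> = id\<close>, and \<open>\<alpha> = id\<close> follows if any two vertices of H are matched in some fibre. For even n the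
  matchings form a 1-factorization of the complete graph on H. For odd n they come from a
  near-1-factorization, the unmatched vertex being the one with which the fibre is opened; when
  Rascal opens a fibre, Gentle opens another one at a new vertex of H.\<close>

section \<open>Automorphisms of Cartesian products\<close>

definition gdist :: "'a rel \<Rightarrow> 'a \<Rightarrow> 'a \<Rightarrow> nat" where
  "gdist R u v = (LEAST k. (u, v) \<in> R ^^ k)"

lemma gdist_le: "(u, v) \<in> R ^^ k \<Longrightarrow> gdist R u v \<le> k"
  unfolding gdist_def by (rule Least_le)

text \<open>Reachability makes the set of walk lengths nonempty, so \<open>LEAST\<close> is
  attained; without it the value of \<open>gdist\<close> is unspecified.\<close>

lemma relpow_gdist: "(u, v) \<in> R\<^sup>* \<Longrightarrow> (u, v) \<in> R ^^ gdist R u v"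
  unfolding gdist_def by (metis LeastI rtrancl_imp_relpow)

lemma gdist_self [simp]: "gdist R u u = 0"
  using gdist_le[where u = u and v = u and R = R and k = 0] by simp

lemma gdist_eq_0D: "(u, v) \<in> R\<^sup>* \<Longrightarrow> gdist R u v = 0 \<Longrightarrow> u = v"
  using relpow_gdist[of u v R] by simp

lemma gdist_triangle:
  assumes "(u, v) \<in> R\<^sup>*" and "(v, w) \<in> R\<^sup>*"
  shows "gdist R u w \<le> gdist R u v + gdist R v w"
  by (rule gdist_le) (use assms relpow_gdist[of _ _ R] in \<open>auto simp: relpow_add\<close>)

text \<open>\<open>connected\<close> refers to the symmetric closure of the arcs. The arcs of a
  \<open>pair_graph\<close> are symmetric already, so directed walks between all pairs of vertices
  exist.\<close>

lemma connected_rtrancl: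
  assumes "pair_graph G" and "connected (with_proj G)" and "u \<in> pverts G" and "v \<in> pverts G"
  shows "(u, v) \<in> (parcs G)\<^sup>*"
proof -
  interpret pair_graph G by fact
  have "strongly_connected (with_proj G)"
    using symmetric_connected_imp_strongly_connected[OF _ assms(2)] pair_sym_arcs by simp
  then have "u \<rightarrow>\<^sup>*\<^bsub>with_proj G\<^esub> v"
    using assms(3,4) by (auto simp: strongly_connected_def)
  then have "(u, v) \<in> rtrancl_on (pverts G) (parcs G)"
    by (simp add: reachable_def)
  then show ?thesis by (rule rtrancl_on_rtranclI)
qed

lemma pair_graph_parcsD:
  assumes "pair_graph G" and "(u, v) \<in> parcs G"
  shows "u \<in> pverts G" and "v \<in> pverts G" and "u \<noteq> v" and "(v, u) \<in> parcs G"
proof -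
  interpret pair_graph G by fact
  show "u \<in> pverts G" "v \<in> pverts G" "u \<noteq> v"
    using assms(2) in_arcsD1 in_arcsD2 no_loops' by auto
  show "(v, u) \<in> parcs G"
    using assms(2) pair_sym_arcs by (auto simp: symmetric_def dest: symD)
qed

lemma pair_graph_finite: "pair_graph G \<Longrightarrow> finite (pverts G)"
  by (simp add: pair_fin_digraph.pair_finite_verts pair_graph_def pair_digraph_def)

lemma pair_graphI:
  assumes "finite (pverts G)" and "parcs G \<subseteq> pverts G \<times> pverts G" and "sym (parcs G)"
    and "\<And>u. (u, u) \<notin> parcs G"
  shows "pair_graph G"
proof -
  have "finite (parcs G)"
    using assms(1,2) by (meson finite_SigmaI finite_subset)
  with assms show ?thesis
    by unfold_locales (auto simp: symmetric_def)
qed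

text \<open>The product is presented by coordinate maps on a set \<open>V\<close> and not as a set
  of pairs, so that one graph can carry several product structures: the coordinates of
  \<open>H \<box> F\<close> before and after an automorphism is applied.\<close>

locale coordinates =
  fixes V :: "'v set" and E :: "'v rel"
    and P :: "'p pair_pre_digraph" and Q :: "'q pair_pre_digraph"
    and p :: "'v \<Rightarrow> 'p" and q :: "'v \<Rightarrow> 'q"
  assumes graph_P: "pair_graph P" and graph_Q: "pair_graph Q"
    and connected_P: "connected (with_proj P)" and connected_Q: "connected (with_proj Q)"
    and bij: "bij_betw (\<lambda>v. (p v, q v)) V (pverts P \<times> pverts Q)"
    and E_sub: "E \<subseteq> V \<times> V"
    and E_iff: "\<And>u v. u \<in> V \<Longrightarrow> v \<in> V \<Longrightarrow>
      (u, v) \<in> E \<longleftrightarrow> ((p u, q u), (p v, q v)) \<in> parcs (P \<box> Q)"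
begin

lemma coords_in: "v \<in> V \<Longrightarrow> p v \<in> pverts P" "v \<in> V \<Longrightarrow> q v \<in> pverts Q"
  using bij_betwE[OF bij] by auto

lemma E_cases:
  assumes "u \<in> V" and "v \<in> V"
  shows "(u, v) \<in> E \<longleftrightarrow>
    (p u, p v) \<in> parcs P \<and> q u = q v \<or> p u = p v \<and> (q u, q v) \<in> parcs Q"
  using E_iff[OF assms] coords_in assms by (auto simp: cartesian_product_def)

lemma coords_ex:
  assumes "x \<in> pverts P" and "y \<in> pverts Q"
  obtains w where "w \<in> V" and "p w = x" and "q w = y"
proof -
  have "(x, y) \<in> (\<lambda>v. (p v, q v)) ` V"
    using assms bij by (auto simp: bij_betw_def)
  then show ?thesis using that by auto
qed

lemma coords_eqI: "u \<in> V \<Longrightarrow> v \<in> V \<Longrightarrow> p u = p v \<Longrightarrow> q u = q v \<Longrightarrow> u = v"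
  using bij by (auto simp: bij_betw_def inj_on_def)

lemma finite_V: "finite V"
  using bij_betw_finite[OF bij] pair_graph_finite[OF graph_P] pair_graph_finite[OF graph_Q]
  by simp

text \<open>Facts about one kind of layer transfer to the other by interpreting the locale with the
  factors exchanged.\<close>

lemma coordinates_swap: "coordinates V E Q P q p"
proof (rule coordinates.intro)
  have "bij_betw prod.swap (pverts P \<times> pverts Q) (pverts Q \<times> pverts P)"
    by (auto simp: bij_betw_def)
  from bij_betw_trans[OF bij this]
  show "bij_betw (\<lambda>v. (q v, p v)) V (pverts Q \<times> pverts P)" by (simp add: comp_def)
  show "(u, v) \<in> E \<longleftrightarrow> ((q u, p u), (q v, p v)) \<in> parcs (Q \<box> P)" if "u \<in> V" "v \<in> V" for u v
    using E_cases[OF that] coords_in that by (auto simp: cartesian_product_def)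
qed (fact graph_P graph_Q connected_P connected_Q E_sub)+

lemma E_sym: "(u, v) \<in> E \<Longrightarrow> (v, u) \<in> E"
  using E_sub E_cases[of u v] E_cases[of v u] pair_graph_parcsD(4)[OF graph_P]
    pair_graph_parcsD(4)[OF graph_Q] by fastforce

lemma E_irrefl: "(u, u) \<notin> E"
  using E_sub E_cases[of u u] pair_graph_parcsD(3)[OF graph_P] pair_graph_parcsD(3)[OF graph_Q]
  by fastforce

text \<open>An arc moves exactly one coordinate, so the steps of a walk divide into a walk in
  \<open>P\<close> and a walk in \<open>Q\<close>.\<close>

lemma relpow_split:
  "(u, v) \<in> E ^^ k \<Longrightarrow> u \<in> V \<Longrightarrow>
    v \<in> V \<and> (\<exists>i j. i + j = k \<and> (p u, p v) \<in> parcs P ^^ i \<and> (q u, q v) \<in> parcs Q ^^ j)"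
proof (induction k arbitrary: v)
  case (Suc k)
  then obtain w where w: "(u, w) \<in> E ^^ k" "(w, v) \<in> E" by auto
  from Suc.IH[OF w(1) Suc.prems(2)] obtain i j where ij: "w \<in> V" "i + j = k"
    "(p u, p w) \<in> parcs P ^^ i" "(q u, q w) \<in> parcs Q ^^ j" by auto
  have v: "v \<in> V" using w(2) E_sub by auto
  from w(2) E_cases[OF ij(1) v]
  consider "(p w, p v) \<in> parcs P" "q w = q v" | "p w = p v" "(q w, q v) \<in> parcs Q"
    by auto
  then show ?case
  proof cases
    case 1
    then have "(p u, p v) \<in> parcs P ^^ Suc i" "(q u, q v) \<in> parcs Q ^^ j"
      using ij by auto
    then show ?thesis using ij(2) v by (metis add_Suc)
  next
    case 2
    then have "(p u, p v) \<in> parcs P ^^ i" "(q u, q v) \<in> parcs Q ^^ Suc j"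
      using ij by auto
    then show ?thesis using ij(2) v by (metis add_Suc_right)
  qed
qed auto

text \<open>A walk in \<open>P\<close> can be performed inside the layer of \<open>u\<close>, the
  other coordinate being kept.\<close>

lemma relpow_lift:
  "(p u, x) \<in> parcs P ^^ k \<Longrightarrow> u \<in> V \<Longrightarrow> \<exists>v\<in>V. p v = x \<and> q v = q u \<and> (u, v) \<in> E ^^ k"
proof (induction k arbitrary: x)
  case (Suc k)
  then obtain y where y: "(p u, y) \<in> parcs P ^^ k" "(y, x) \<in> parcs P" by auto
  from Suc.IH[OF y(1) Suc.prems(2)] obtain w where w: "w \<in> V" "p w = y" "q w = q u"
    "(u, w) \<in> E ^^ k" by auto
  obtain v where v: "v \<in> V" "p v = x" "q v = q u"
    using coords_ex pair_graph_parcsD(2)[OF graph_P y(2)] coords_in(2)[OF Suc.prems(2)] by metis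
  have "(w, v) \<in> E" using E_cases[OF w(1) v(1)] w v y(2) by auto
  then show ?case using v w(4) by auto
qed auto

lemma rtrancl_P: "u \<in> V \<Longrightarrow> v \<in> V \<Longrightarrow> (p u, p v) \<in> (parcs P)\<^sup>*"
  using connected_rtrancl[OF graph_P connected_P] coords_in by auto

lemma rtrancl_Q: "u \<in> V \<Longrightarrow> v \<in> V \<Longrightarrow> (q u, q v) \<in> (parcs Q)\<^sup>*"
  using connected_rtrancl[OF graph_Q connected_Q] coords_in by auto

text \<open>Upper bound: lift a shortest walk of \<open>P\<close>, then one of \<open>Q\<close> from
  its end point. Lower bound: a shortest walk projects to walks in the factors whose lengths add up
  to its own.\<close>

lemma gdist_coords:
  assumes "u \<in> V" and "v \<in> V"
  shows "gdist E u v = gdist (parcs P) (p u) (p v) + gdist (parcs Q) (q u) (q v)"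
proof -
  define i where "i = gdist (parcs P) (p u) (p v)"
  define j where "j = gdist (parcs Q) (q u) (q v)"
  have i: "(p u, p v) \<in> parcs P ^^ i"
    unfolding i_def using rtrancl_P[OF assms] by (rule relpow_gdist)
  have j: "(q u, q v) \<in> parcs Q ^^ j"
    unfolding j_def using rtrancl_Q[OF assms] by (rule relpow_gdist)
  obtain w where w: "w \<in> V" "p w = p v" "q w = q u" "(u, w) \<in> E ^^ i"
    using relpow_lift[OF i assms(1)] by auto
  interpret swap: coordinates V E Q P q p by (rule coordinates_swap)
  have "(q w, q v) \<in> parcs Q ^^ j" using j w(3) by simp
  from swap.relpow_lift[OF this w(1)] obtain v' where
    v': "v' \<in> V" "q v' = q v" "p v' = p w" "(w, v') \<in> E ^^ j" by auto
  have "v' = v" using coords_eqI[of v' v] assms v' w by auto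
  with v'(4) w(4) have walk: "(u, v) \<in> E ^^ (i + j)" by (auto simp: relpow_add)
  then have "(u, v) \<in> E ^^ gdist E u v"
    by (intro relpow_gdist) (auto intro: relpow_imp_rtrancl)
  from relpow_split[OF this assms(1)] have "i + j \<le> gdist E u v"
    unfolding i_def j_def using gdist_le by (metis add_mono)
  with gdist_le[OF walk] show ?thesis by (simp add: i_def j_def)
qed

end

section \<open>Induced subgraphs with natural numbers as vertices, and isomorphisms\<close>

definition relabel_induced :: "('v \<Rightarrow> nat) \<Rightarrow> 'v set \<Rightarrow> 'v rel \<Rightarrow> nat pair_pre_digraph" where
  "relabel_induced \<iota> K E =
    \<lparr> pverts = \<iota> ` K, parcs = {(\<iota> u, \<iota> v) | u v. u \<in> K \<and> v \<in> K \<and> (u, v) \<in> E} \<rparr>"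

lemma pair_graph_relabel_induced:
  assumes "finite K" and "inj_on \<iota> K"
    and "\<And>u v. (u, v) \<in> E \<Longrightarrow> (v, u) \<in> E" and "\<And>u. (u, u) \<notin> E"
  shows "pair_graph (relabel_induced \<iota> K E)"
proof (rule pair_graphI)
  show "finite (pverts (relabel_induced \<iota> K E))"
    using assms(1) by (simp add: relabel_induced_def)
  show "parcs (relabel_induced \<iota> K E)
      \<subseteq> pverts (relabel_induced \<iota> K E) \<times> pverts (relabel_induced \<iota> K E)"
    by (auto simp: relabel_induced_def)
  show "sym (parcs (relabel_induced \<iota> K E))"
    using assms(3) by (auto simp: relabel_induced_def sym_def)
  show "(u, u) \<notin> parcs (relabel_induced \<iota> K E)" for u
  proof
    assume "(u, u) \<in> parcs (relabel_induced \<iota> K E)"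
    then obtain a b where "a \<in> K" "b \<in> K" "(a, b) \<in> E" "\<iota> a = \<iota> b"
      by (auto simp: relabel_induced_def)
    then show False using assms(2,4) by (metis inj_onD)
  qed
qed

lemma relabel_induced_arc_iff:
  assumes "inj_on \<iota> K" and "u \<in> K" and "v \<in> K"
  shows "(\<iota> u, \<iota> v) \<in> parcs (relabel_induced \<iota> K E) \<longleftrightarrow> (u, v) \<in> E"
proof
  assume "(\<iota> u, \<iota> v) \<in> parcs (relabel_induced \<iota> K E)"
  then obtain a b where "a \<in> K" "b \<in> K" "(a, b) \<in> E" "\<iota> u = \<iota> a" "\<iota> v = \<iota> b"
    by (auto simp: relabel_induced_def)
  then show "(u, v) \<in> E" using assms by (metis inj_onD)
qed (use assms in \<open>auto simp: relabel_induced_def\<close>)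

text \<open>An isomorphism of digraphs also has to map arcs, which \<open>map_prod f f\<close> does.
  The third assumption gives every arc of \<open>G'\<close> end points in the image of
  \<open>f\<close>.\<close>

lemma digraph_isoI:
  assumes "pair_graph G" and "bij_betw f (pverts G) (pverts G')"
    and "parcs G' \<subseteq> pverts G' \<times> pverts G'"
    and "\<And>u v. u \<in> pverts G \<Longrightarrow> v \<in> pverts G \<Longrightarrow> (f u, f v) \<in> parcs G' \<longleftrightarrow> (u, v) \<in> parcs G"
  shows "digraph_iso (with_proj G) (with_proj G')"
proof -
  interpret pair_graph G by fact
  define h where "h = \<lparr> iso_verts = f, iso_arcs = map_prod f f, iso_head = snd, iso_tail = fst \<rparr>"
  have sub: "parcs G \<subseteq> pverts G \<times> pverts G"
    using in_arcsD1 in_arcsD2 by auto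
  have inj: "inj_on f (pverts G)" and img: "f ` pverts G = pverts G'"
    using assms(2) by (auto simp: bij_betw_def)
  have "inj_on (map_prod f f) (parcs G)"
    using map_prod_inj_on[OF inj inj] sub by (rule inj_on_subset)
  then have "pre_digraph.digraph_isomorphism (with_proj G) h"
    using inj wf_digraph_axioms by (auto simp: pre_digraph.digraph_isomorphism_def h_def)
  moreover have "parcs G' = map_prod f f ` parcs G"
  proof
    show "parcs G' \<subseteq> map_prod f f ` parcs G"
    proof
      fix e assume e: "e \<in> parcs G'"
      then have "e \<in> f ` pverts G \<times> f ` pverts G" using assms(3) unfolding img by blast
      then obtain u v where uv: "u \<in> pverts G" "v \<in> pverts G" "e = (f u, f v)" by blast
      then have "(u, v) \<in> parcs G" using e assms(4)[of u v] by blast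
      then show "e \<in> map_prod f f ` parcs G" unfolding uv(3) by (rule rev_image_eqI) simp
    qed
    show "map_prod f f ` parcs G \<subseteq> parcs G'"
      using sub assms(4) by auto
  qed
  then have "with_proj G' = app_iso h (with_proj G)"
    using img by (simp add: with_proj_def app_iso_def h_def)
  ultimately show ?thesis unfolding digraph_iso_def by blast
qed

section \<open>Two product structures on the same graph\<close>

locale two_coordinates =
  AB: coordinates V E A B a b + CD: coordinates V E C D c d
  for V :: "'v set" and E :: "'v rel"
    and A :: "'a pair_pre_digraph" and B :: "'b pair_pre_digraph"
    and a :: "'v \<Rightarrow> 'a" and b :: "'v \<Rightarrow> 'b"
    and C :: "'c pair_pre_digraph" and D :: "'d pair_pre_digraph"
    and c :: "'v \<Rightarrow> 'c" and d :: "'v \<Rightarrow> 'd"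
begin

text \<open>The vertex w lies on a geodesic from u to v, and layers are geodesically convex.\<close>

lemma layer_box:
  assumes V: "u \<in> V" "v \<in> V" "w \<in> V"
    and "b u = b v" and "c w = c u" and "d w = d v"
  shows "b w = b u"
proof -
  have "gdist E u w + gdist E w v = gdist E u v"
    using assms by (simp add: CD.gdist_coords)
  moreover have "gdist (parcs A) (a u) (a v)
      \<le> gdist (parcs A) (a u) (a w) + gdist (parcs A) (a w) (a v)"
    by (rule gdist_triangle) (use V AB.rtrancl_P in auto)
  ultimately have "gdist (parcs B) (b u) (b w) = 0"
    using assms by (simp add: AB.gdist_coords)
  then show ?thesis using gdist_eq_0D[OF AB.rtrancl_Q[OF V(1,3)]] by simp
qed

text \<open>The layer of \<open>o'\<close> with \<open>b\<close> fixed is a copy of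
  \<open>A\<close>. By \<open>layer_box\<close>, a vertex that combines the \<open>c\<close> of one
  vertex of the layer with the \<open>d\<close> of another is again in the layer. So the layer is
  the product of its part \<open>K\<close> with \<open>c\<close> fixed and its part \<open>L\<close>
  with \<open>d\<close> fixed.\<close>

lemma layer_intersection_factor:
  assumes o: "o' \<in> V" and inj: "inj_on \<iota> {v \<in> V. b v = b o' \<and> c v = c o'}"
  shows "cartesian_factor (relabel_induced \<iota> {v \<in> V. b v = b o' \<and> c v = c o'} E) A"
proof -
  define K where "K = {v \<in> V. b v = b o' \<and> c v = c o'}"
  define L where "L = {v \<in> V. b v = b o' \<and> d v = d o'}"
  have finite: "finite K" "finite L"
    using AB.finite_V by (auto simp: K_def L_def)
  \<comment> \<open>\<open>cartesian_factor\<close> asks for a cofactor over the naturals, so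
    \<open>L\<close> is numbered as well.\<close>
  obtain \<kappa> :: "'v \<Rightarrow> nat" where \<kappa>: "inj_on \<kappa> L"
    using finite_imp_inj_to_nat_seg[OF finite(2)] by metis
  have \<iota>: "inj_on \<iota> K" using inj by (simp add: K_def)
  define X where "X = relabel_induced \<iota> K E"
  define Y where "Y = relabel_induced \<kappa> L E"
  have X: "pair_graph X" and Y: "pair_graph Y"
    unfolding X_def Y_def
    by (rule pair_graph_relabel_induced; fact finite \<iota> \<kappa> AB.E_sym AB.E_irrefl)+
  \<comment> \<open>\<open>lift\<close> embeds \<open>A\<close> as the layer through
    \<open>o'\<close>.\<close>
  define lift where "lift x = (SOME v. v \<in> V \<and> a v = x \<and> b v = b o')" for x
  have lift: "lift x \<in> V" "a (lift x) = x" "b (lift x) = b o'" if "x \<in> pverts A" for x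
  proof -
    have "\<exists>v. v \<in> V \<and> a v = x \<and> b v = b o'"
      using AB.coords_ex[OF that AB.coords_in(2)[OF o]] by metis
    then have "lift x \<in> V \<and> a (lift x) = x \<and> b (lift x) = b o'"
      unfolding lift_def by (rule someI_ex)
    then show "lift x \<in> V" "a (lift x) = x" "b (lift x) = b o'" by auto
  qed
  \<comment> \<open>The projections of the layer to \<open>K\<close> and \<open>L\<close> along the
    second product structure.\<close>
  define prK where "prK v = (SOME w. w \<in> V \<and> c w = c o' \<and> d w = d v)" for v
  define prL where "prL v = (SOME w. w \<in> V \<and> c w = c v \<and> d w = d o')" for v
  have prK: "prK v \<in> K" "d (prK v) = d v" if "v \<in> V" "b v = b o'" for v
  proof -
    have "\<exists>w. w \<in> V \<and> c w = c o' \<and> d w = d v"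
      using CD.coords_ex[OF CD.coords_in(1)[OF o] CD.coords_in(2)[OF that(1)]] by metis
    then have w: "prK v \<in> V \<and> c (prK v) = c o' \<and> d (prK v) = d v"
      unfolding prK_def by (rule someI_ex)
    with layer_box[of o' v "prK v"] o that have "b (prK v) = b o'" by auto
    with w show "prK v \<in> K" "d (prK v) = d v" by (auto simp: K_def)
  qed
  have prL: "prL v \<in> L" "c (prL v) = c v" if "v \<in> V" "b v = b o'" for v
  proof -
    have "\<exists>w. w \<in> V \<and> c w = c v \<and> d w = d o'"
      using CD.coords_ex[OF CD.coords_in(1)[OF that(1)] CD.coords_in(2)[OF o]] by metis
    then have w: "prL v \<in> V \<and> c (prL v) = c v \<and> d (prL v) = d o'"
      unfolding prL_def by (rule someI_ex)
    with layer_box[of v o' "prL v"] o that have "b (prL v) = b o'" by auto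
    with w show "prL v \<in> L" "c (prL v) = c v" by (auto simp: L_def)
  qed
  define f where "f x = (\<iota> (prK (lift x)), \<kappa> (prL (lift x)))" for x
  have verts: "pverts (X \<box> Y) = \<iota> ` K \<times> \<kappa> ` L"
    by (simp add: cartesian_product_def X_def Y_def relabel_induced_def)
  have inj_f: "inj_on f (pverts A)"
  proof (rule inj_onI)
    fix x y assume x: "x \<in> pverts A" and y: "y \<in> pverts A" and eq: "f x = f y"
    have "prK (lift x) = prK (lift y)"
      using eq inj_onD[OF \<iota>] prK lift x y by (simp add: f_def)
    moreover have "prL (lift x) = prL (lift y)"
      using eq inj_onD[OF \<kappa>] prL lift x y by (simp add: f_def)
    ultimately have "lift x = lift y"
      using CD.coords_eqI[of "lift x" "lift y"] prK(2) prL(2) lift x y by metis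
    then show "x = y" using lift(2) x y by metis
  qed
  have "f ` pverts A = \<iota> ` K \<times> \<kappa> ` L"
  proof
    show "f ` pverts A \<subseteq> \<iota> ` K \<times> \<kappa> ` L"
      using prK(1) prL(1) lift by (auto simp: f_def)
    show "\<iota> ` K \<times> \<kappa> ` L \<subseteq> f ` pverts A"
    proof
      fix z assume "z \<in> \<iota> ` K \<times> \<kappa> ` L"
      then obtain s t where z: "z = (\<iota> s, \<kappa> t)" and s: "s \<in> K" and t: "t \<in> L" by auto
      have sV: "s \<in> V" "b s = b o'" "c s = c o'" and tV: "t \<in> V" "b t = b o'" "d t = d o'"
        using s t by (auto simp: K_def L_def)
      \<comment> \<open>The vertex with the \<open>c\<close> of \<open>t\<close> and the
        \<open>d\<close> of \<open>s\<close> is the required preimage; \<open>layer_box\<close> puts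
        it into the layer.\<close>
      obtain v where v: "v \<in> V" "c v = c t" "d v = d s"
        using CD.coords_ex[OF CD.coords_in(1)[OF tV(1)] CD.coords_in(2)[OF sV(1)]] by metis
      have bv: "b v = b o'" using layer_box[of t s v] sV tV v by auto
      have av: "a v \<in> pverts A" using AB.coords_in v by auto
      have "lift (a v) = v"
        using AB.coords_eqI[of "lift (a v)" v] lift[OF av] v bv by auto
      moreover have "prK v = s"
        using CD.coords_eqI[of "prK v" s] prK[OF v(1) bv] sV v by (auto simp: K_def)
      moreover have "prL v = t"
        using CD.coords_eqI[of "prL v" t] prL[OF v(1) bv] tV v by (auto simp: L_def)
      ultimately have "z = f (a v)" using z by (simp add: f_def)
      then show "z \<in> f ` pverts A" using av by auto
    qed
  qed
  with inj_f verts have bij: "bij_betw f (pverts A) (pverts (X \<box> Y))"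
    by (simp add: bij_betw_def)
  have arcs: "(f x, f y) \<in> parcs (X \<box> Y) \<longleftrightarrow> (x, y) \<in> parcs A"
    if x: "x \<in> pverts A" and y: "y \<in> pverts A" for x y
  proof -
    define u v where "u = lift x" and "v = lift y"
    have u: "u \<in> V" "b u = b o'" "a u = x" and v: "v \<in> V" "b v = b o'" "a v = y"
      using lift x y by (auto simp: u_def v_def)
    note Ku = prK[OF u(1,2)] and Kv = prK[OF v(1,2)] and Lu = prL[OF u(1,2)] and Lv = prL[OF v(1,2)]
    have KV: "prK u \<in> V" "prK v \<in> V" "prL u \<in> V" "prL v \<in> V"
      "c (prK u) = c o'" "c (prK v) = c o'" "d (prL u) = d o'" "d (prL v) = d o'"
      using Ku Kv Lu Lv by (auto simp: K_def L_def)
    \<comment> \<open>On \<open>K\<close> the coordinate \<open>c\<close> is constant and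
      \<open>C\<close> has no loops, so adjacency there is adjacency of the
      \<open>d\<close>-coordinates. On \<open>L\<close> the roles are exchanged.\<close>
    have K_arc: "(prK u, prK v) \<in> E \<longleftrightarrow> (d u, d v) \<in> parcs D"
      using CD.E_cases[OF KV(1,2)] KV Ku Kv pair_graph_parcsD(3)[OF CD.graph_P] by auto
    have L_arc: "(prL u, prL v) \<in> E \<longleftrightarrow> (c u, c v) \<in> parcs C"
      using CD.E_cases[OF KV(3,4)] KV Lu Lv pair_graph_parcsD(3)[OF CD.graph_Q] by auto
    have K_eq: "\<iota> (prK u) = \<iota> (prK v) \<longleftrightarrow> d u = d v"
      using inj_onD[OF \<iota> _ Ku(1) Kv(1)] CD.coords_eqI[OF KV(1,2)] KV Ku Kv by metis
    have L_eq: "\<kappa> (prL u) = \<kappa> (prL v) \<longleftrightarrow> c u = c v"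
      using inj_onD[OF \<kappa> _ Lu(1) Lv(1)] CD.coords_eqI[OF KV(3,4)] KV Lu Lv by metis
    have "(f x, f y) \<in> parcs (X \<box> Y) \<longleftrightarrow>
        (\<iota> (prK u), \<iota> (prK v)) \<in> parcs X \<and> \<kappa> (prL u) = \<kappa> (prL v) \<or>
        \<iota> (prK u) = \<iota> (prK v) \<and> (\<kappa> (prL u), \<kappa> (prL v)) \<in> parcs Y"
      using Ku Kv Lu Lv
      by (auto simp: cartesian_product_def f_def u_def v_def X_def Y_def relabel_induced_def)
    also have "\<dots> \<longleftrightarrow> (d u, d v) \<in> parcs D \<and> c u = c v \<or> d u = d v \<and> (c u, c v) \<in> parcs C"
      unfolding X_def Y_def relabel_induced_arc_iff[OF \<iota> Ku(1) Kv(1)]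
        relabel_induced_arc_iff[OF \<kappa> Lu(1) Lv(1)] K_arc L_arc K_eq L_eq ..
    also have "\<dots> \<longleftrightarrow> (u, v) \<in> E" using CD.E_cases[OF u(1) v(1)] by auto
    also have "\<dots> \<longleftrightarrow> (x, y) \<in> parcs A"
      using AB.E_cases[OF u(1) v(1)] u v pair_graph_parcsD(3)[OF AB.graph_Q] by auto
    finally show ?thesis .
  qed
  have "parcs (X \<box> Y) \<subseteq> pverts (X \<box> Y) \<times> pverts (X \<box> Y)"
    by (auto simp: cartesian_product_def)
  then have "digraph_iso (with_proj A) (with_proj (X \<box> Y))"
    using digraph_isoI[OF AB.graph_P bij] arcs by blast
  with X Y show ?thesis
    unfolding cartesian_factor_def X_def K_def by blast
qed

text \<open>By \<open>layer_intersection_factor\<close> the two layers meet in a common factor of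
  \<open>A\<close> and \<open>D\<close>; two points would make it non-trivial.\<close>

lemma layers_meet_in_point:
  assumes "relatively_prime A D" and u: "u \<in> V" and v: "v \<in> V" and eq: "b u = b v" "c u = c v"
  shows "u = v"
proof (rule ccontr)
  assume "u \<noteq> v"
  define K where "K = {w \<in> V. b w = b u \<and> c w = c u}"
  have "finite K" using AB.finite_V by (simp add: K_def)
  then obtain \<iota> :: "'v \<Rightarrow> nat" where \<iota>: "inj_on \<iota> K"
    using finite_imp_inj_to_nat_seg by metis
  have "{u, v} \<subseteq> K" using u v eq by (auto simp: K_def)
  then have "card {u, v} \<le> card K" using \<open>finite K\<close> by (rule card_mono[rotated])
  with \<open>u \<noteq> v\<close> have "nontrivial (relabel_induced \<iota> K E)"
    using card_image[OF \<iota>] by (simp add: nontrivial_def relabel_induced_def)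
  moreover have "cartesian_factor (relabel_induced \<iota> K E) A"
    using layer_intersection_factor[OF u] \<iota> by (simp add: K_def)
  moreover have "cartesian_factor (relabel_induced \<iota> K E) D"
  proof -
    \<comment> \<open>Exchanging the two structures, and the factors within each, exhibits the same
      set as part of a layer that is a copy of \<open>D\<close>.\<close>
    interpret swap: two_coordinates V E D C d c B A b a
      using AB.coordinates_swap CD.coordinates_swap by (simp add: two_coordinates_def)
    have "K = {w \<in> V. c w = c u \<and> b w = b u}" by (auto simp: K_def)
    then show ?thesis using swap.layer_intersection_factor[OF u] \<iota> by simp
  qed
  ultimately show False using assms(1) by (auto simp: relatively_prime_def)
qed

end

section \<open>Splitting the automorphisms of a product of relatively prime graphs\<close>

theorem automorphism_relatively_prime_product:
  assumes H: "pair_graph H" "connected (with_proj H)" and F: "pair_graph F" "connected (with_proj F)"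
    and prime: "relatively_prime H F" and aut: "automorphism (H \<box> F) \<sigma>"
  obtains \<alpha> \<beta> where "bij_betw \<alpha> (pverts H) (pverts H)" and "bij_betw \<beta> (pverts F) (pverts F)"
    and "\<And>h f. h \<in> pverts H \<Longrightarrow> f \<in> pverts F \<Longrightarrow> \<sigma> (h, f) = (\<alpha> h, \<beta> f)"
proof -
  define V where "V = pverts H \<times> pverts F"
  define E where "E = parcs (H \<box> F)"
  have verts: "pverts (H \<box> F) = V" by (simp add: cartesian_product_def V_def)
  have \<sigma>: "bij_betw \<sigma> V V" and \<sigma>_arc: "\<And>u v. u \<in> V \<Longrightarrow> v \<in> V \<Longrightarrow> (\<sigma> u, \<sigma> v) \<in> E \<longleftrightarrow> (u, v) \<in> E"
    using aut verts by (auto simp: automorphism_def E_def)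
  have E_sub: "E \<subseteq> V \<times> V" by (auto simp: E_def V_def cartesian_product_def)
  have "coordinates V E H F fst snd"
    by (rule coordinates.intro) (use H F E_sub in \<open>simp_all add: E_def V_def bij_betw_def\<close>)
  \<comment> \<open>The second structure reads the coordinates after applying
    \<open>\<sigma>\<close>, which preserves adjacency.\<close>
  moreover have "coordinates V E H F (fst \<circ> \<sigma>) (snd \<circ> \<sigma>)"
    by (rule coordinates.intro)
      (use H F E_sub \<sigma> \<sigma>_arc in \<open>simp_all add: E_def flip: V_def\<close>)
  ultimately interpret two_coordinates V E H F fst snd H F "fst \<circ> \<sigma>" "snd \<circ> \<sigma>"
    by (rule two_coordinates.intro)
  have meet: "u = v" if "u \<in> V" "v \<in> V" "snd u = snd v" "fst (\<sigma> u) = fst (\<sigma> v)" for u v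
    using layers_meet_in_point[OF prime that(1,2)] that(3,4) by simp
  have snd_eq: "snd (\<sigma> u) = snd (\<sigma> v)" if uv: "u \<in> V" "v \<in> V" "snd u = snd v" for u v
  proof -
    \<comment> \<open>The image of \<open>w\<close> mixes those of \<open>u\<close> and
      \<open>v\<close>, so by convexity \<open>w\<close> lies in their H-layer. Its image has the
      first coordinate of the image of \<open>u\<close>, and \<open>meet\<close> identifies the
      two.\<close>
    obtain w where w: "w \<in> V" "fst (\<sigma> w) = fst (\<sigma> u)" "snd (\<sigma> w) = snd (\<sigma> v)"
      using CD.coords_ex[OF CD.coords_in(1)[OF uv(1)] CD.coords_in(2)[OF uv(2)]] by auto
    have "snd w = snd u" using layer_box[of u v w] uv w by auto
    then have "w = u" using meet w uv by auto
    then show ?thesis using w by auto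
  qed
  obtain h0 f0 where h0: "h0 \<in> pverts H" and f0: "f0 \<in> pverts F"
    using H(2) F(2) by (auto simp: connected_def strongly_connected_def)
  define \<beta> where "\<beta> f = snd (\<sigma> (h0, f))" for f
  have \<beta>: "snd (\<sigma> (h, f)) = \<beta> f" if "h \<in> pverts H" "f \<in> pverts F" for h f
    unfolding \<beta>_def using snd_eq that h0 by (auto simp: V_def)
  have surj: "\<exists>u\<in>V. \<sigma> u = v" if "v \<in> V" for v
    using bij_betw_imp_surj_on[OF \<sigma>] that by (metis imageE)
  have into: "\<sigma> u \<in> V" if "u \<in> V" for u
    using \<sigma> that by (auto simp: bij_betw_def)
  have "\<beta> ` pverts F = pverts F"
  proof
    show "\<beta> ` pverts F \<subseteq> pverts F"
      using into h0 by (auto simp: \<beta>_def V_def mem_Times_iff)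
    show "pverts F \<subseteq> \<beta> ` pverts F"
    proof
      fix f assume "f \<in> pverts F"
      then obtain h' f' where "h' \<in> pverts H" "f' \<in> pverts F" "\<sigma> (h', f') = (h0, f)"
        using surj[of "(h0, f)"] h0 by (auto simp: V_def)
      then show "f \<in> \<beta> ` pverts F" using \<beta>[of h' f'] by force
    qed
  qed
  then have \<beta>_bij: "bij_betw \<beta> (pverts F) (pverts F)"
    using pair_graph_finite[OF F(1)] by (simp add: bij_betw_def eq_card_imp_inj_on)
  have fst_eq: "fst (\<sigma> u) = fst (\<sigma> v)" if uv: "u \<in> V" "v \<in> V" "fst u = fst v" for u v
  proof -
    obtain w where w: "w \<in> V" "fst (\<sigma> w) = fst (\<sigma> u)" "snd (\<sigma> w) = snd (\<sigma> v)"
      using CD.coords_ex[OF CD.coords_in(1)[OF uv(1)] CD.coords_in(2)[OF uv(2)]] by auto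
    interpret swap: two_coordinates V E F H snd fst H F "fst \<circ> \<sigma>" "snd \<circ> \<sigma>"
      using AB.coordinates_swap CD.coordinates_axioms by (simp add: two_coordinates_def)
    have "fst w = fst u" using swap.layer_box[of u v w] uv w by auto
    \<comment> \<open>Injectivity of \<open>\<beta>\<close> takes the place of \<open>meet\<close>
      here: the images of \<open>w\<close> and \<open>v\<close> have the same second
      coordinate.\<close>
    moreover have "snd w = snd v"
    proof -
      have "\<beta> (snd w) = \<beta> (snd v)"
        using \<beta>[of "fst w" "snd w"] \<beta>[of "fst v" "snd v"] w uv by (auto simp: V_def)
      then show ?thesis
        using \<beta>_bij w(1) uv(2) by (auto simp: V_def bij_betw_def dest: inj_onD)
    qed
    ultimately have "w = v" using uv(3) by (simp add: prod_eq_iff)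
    then show ?thesis using w by auto
  qed
  define \<alpha> where "\<alpha> h = fst (\<sigma> (h, f0))" for h
  have \<alpha>: "fst (\<sigma> (h, f)) = \<alpha> h" if "h \<in> pverts H" "f \<in> pverts F" for h f
    unfolding \<alpha>_def using fst_eq that f0 by (auto simp: V_def)
  have "\<alpha> ` pverts H = pverts H"
  proof
    show "\<alpha> ` pverts H \<subseteq> pverts H"
      using into f0 by (auto simp: \<alpha>_def V_def mem_Times_iff)
    show "pverts H \<subseteq> \<alpha> ` pverts H"
    proof
      fix h assume "h \<in> pverts H"
      then obtain h' f' where "h' \<in> pverts H" "f' \<in> pverts F" "\<sigma> (h', f') = (h, f0)"
        using surj[of "(h, f0)"] f0 by (auto simp: V_def)
      then show "h \<in> \<alpha> ` pverts H" using \<alpha>[of h' f'] by force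
    qed
  qed
  then have \<alpha>_bij: "bij_betw \<alpha> (pverts H) (pverts H)"
    using pair_graph_finite[OF H(1)] by (simp add: bij_betw_def eq_card_imp_inj_on)
  show ?thesis
    using that[OF \<alpha>_bij \<beta>_bij] \<alpha> \<beta> by (metis prod.collapse)
qed

section \<open>The distinguishing game\<close>

lemma final_coloring_snoc:
  assumes "u \<notin> fst ` set p"
  shows "final_coloring (p @ [(u, k)]) v = (if v = u then k else final_coloring p v)"
proof -
  have "map_of p u = None" using assms by (simp add: map_of_eq_None_iff)
  then show ?thesis
    by (auto simp: final_coloring_def map_of_append map_add_def split: option.splits)
qed

lemma legal_play_snoc:
  "legal_play G d (p @ [(u, k)]) \<longleftrightarrow>
    legal_play G d p \<and> u \<notin> fst ` set p \<and> u \<in> pverts G \<and> k \<in> {1..d}"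
  by (auto simp: legal_play_def)

lemma legal_play_take: "legal_play G d p \<Longrightarrow> legal_play G d (take k p)"
  by (auto simp: legal_play_def take_map[symmetric] dest: in_set_takeD)

lemma legal_move_ex:
  assumes "1 \<le> d" and "legal_play G d p" and "\<not> complete_play G d p"
  shows "\<exists>x. legal_play G d (p @ [x])"
proof -
  have "fst ` set p \<subseteq> pverts G" using assms(2) by (auto simp: legal_play_def)
  with assms obtain u where "u \<in> pverts G" "u \<notin> fst ` set p"
    by (auto simp: complete_play_def)
  then have "legal_play G d (p @ [(u, 1)])"
    using assms by (simp add: legal_play_snoc)
  then show ?thesis ..
qed

text \<open>The invariant is claimed only for positions in which it is not Gentle's turn. Since
  \<open>step\<close> provides an answer to every legal move of Rascal, Rascal never makes the last
  move, and \<open>final\<close> applies to every complete play that follows the strategy.\<close>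

lemma winning_strategy_by_invariant:
  assumes d: "1 \<le> d"
    and start_Gentle: "first = Gentle \<Longrightarrow> \<exists>x. legal_play G d [x] \<and> I [x]"
    and start_Rascal: "first = Rascal \<Longrightarrow> I []"
    and step: "\<And>p r. I p \<Longrightarrow> legal_play G d (p @ [r]) \<Longrightarrow>
      \<exists>g. legal_play G d (p @ [r, g]) \<and> I (p @ [r, g])"
    and final: "\<And>p. I p \<Longrightarrow> complete_play G d p \<Longrightarrow> distinguishing G (final_coloring p)"
  shows "gentle_has_winning_strategy first G d"
proof -
  define good where "good p x \<longleftrightarrow> legal_play G d (p @ [x]) \<and> I (p @ [x])" for p x
  \<comment> \<open>A strategy must answer every position, also those never reached, so any legal
    move serves where none restores the invariant.\<close>
  define s where
    "s p = (SOME x. legal_play G d (p @ [x]) \<and> ((\<exists>y. good p y) \<longrightarrow> good p x))" for p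
  have s: "legal_play G d (p @ [s p]) \<and> ((\<exists>y. good p y) \<longrightarrow> good p (s p))"
    if legal: "legal_play G d p" "\<not> complete_play G d p" for p
    unfolding s_def
  proof (rule someI_ex)
    show "\<exists>x. legal_play G d (p @ [x]) \<and> ((\<exists>y. good p y) \<longrightarrow> good p x)"
      using legal_move_ex[OF d legal] by (metis good_def)
  qed
  have s_good: "good p (s p)" if "good p x" for p x
  proof -
    have "legal_play G d p" "\<not> complete_play G d p"
      using that by (cases x; auto simp: good_def legal_play_snoc complete_play_def)+
    then show ?thesis using s that by blast
  qed
  have "distinguishing G (final_coloring p)"
    if complete: "complete_play G d p" and follows: "follows first s p" for p
  proof -
    have legal: "legal_play G d p" using complete by (simp add: complete_play_def)
    have no_move: "\<not> legal_play G d (p @ [x])" for x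
      using complete by (cases x) (auto simp: complete_play_def legal_play_snoc)
    \<comment> \<open>Induction in steps of two moves; the base is the empty play or Gentle's first
      move, according to who begins.\<close>
    have inv: "I (take k p)" if "k \<le> length p" "\<not> gentle_to_move first (take k p)" for k
      using that
    proof (induction k rule: less_induct)
      case (less k)
      consider "k = 0" | "k = 1" | j where "k = Suc (Suc j)"
        by (metis One_nat_def nat.exhaust)
      then show ?case
      proof cases
        case 1
        then show ?thesis
          using less.prems start_Rascal by (cases first) (auto simp: gentle_to_move_def)
      next
        case 2
        then have first: "first = Gentle" and len: "0 < length p"
          using less.prems by (auto simp: gentle_to_move_def)
        then have "p ! 0 = s []" using follows by (auto simp: follows_def gentle_to_move_def)
        moreover obtain x where "good [] x"
          using start_Gentle[OF first] by (auto simp: good_def)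
        then have "good [] (s [])" by (rule s_good)
        ultimately show ?thesis using 2 len
          by (simp add: good_def take_Suc_conv_app_nth)
      next
        case 3
        have j: "j < length p" "Suc j < length p" using less.prems 3 by auto
        have "\<not> gentle_to_move first (take j p)"
          using less.prems 3 by (auto simp: gentle_to_move_def)
        then have Ij: "I (take j p)" using less.IH[of j] 3 j by auto
        have t1: "take (Suc j) p = take j p @ [p ! j]"
          using j by (simp add: take_Suc_conv_app_nth)
        have t2: "take k p = take (Suc j) p @ [p ! Suc j]"
          using j 3 by (simp add: take_Suc_conv_app_nth)
        have "legal_play G d (take j p @ [p ! j])"
          using legal_play_take[OF legal] t1 by metis
        from step[OF Ij this] obtain g where "good (take (Suc j) p) g"
          using t1 by (auto simp: good_def)
        then have "good (take (Suc j) p) (s (take (Suc j) p))" by (rule s_good)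
        moreover have "p ! Suc j = s (take (Suc j) p)"
          using follows j less.prems 3 by (auto simp: follows_def gentle_to_move_def)
        ultimately show ?thesis using t2 by (simp add: good_def)
      qed
    qed
    \<comment> \<open>Otherwise the play is empty and Gentle begins, or Rascal moved last;
      \<open>start_Gentle\<close> or \<open>step\<close> then supplies a further legal move.\<close>
    have "\<not> gentle_to_move first p"
    proof
      assume move: "gentle_to_move first p"
      show False
      proof (cases p rule: rev_cases)
        case Nil
        then have "first = Gentle" using move by (simp add: gentle_to_move_def)
        then show False using start_Gentle no_move Nil by auto
      next
        case (snoc q r)
        have "\<not> gentle_to_move first q"
          using move snoc by (auto simp: gentle_to_move_def)
        then have "I q" using inv[of "length q"] snoc by auto
        then show False using step[of q r] legal no_move snoc by auto
      qed
    qed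
    then show ?thesis using inv[of "length p"] final complete by simp
  qed
  then show ?thesis
    using s unfolding gentle_has_winning_strategy_def gentle_strategy_def by blast
qed

lemma game_distinguishing_number_le:
  "1 \<le> d \<Longrightarrow> gentle_has_winning_strategy first G d \<Longrightarrow> game_distinguishing_number first G \<le> enat d"
  unfolding game_distinguishing_number_def by (rule Inf_lower) auto

section \<open>Matchings as involutions, with the unmatched vertices as fixed points\<close>

definition involution_on :: "'a set \<Rightarrow> ('a \<Rightarrow> 'a) \<Rightarrow> bool" where
  "involution_on A \<mu> \<longleftrightarrow> (\<forall>x\<in>A. \<mu> x \<in> A \<and> \<mu> (\<mu> x) = x)"

text \<open>On the residues modulo an odd n, take the reflections \<open>x \<mapsto> 2i - x\<close>.\<close>

lemma near_one_factorization:
  assumes fin: "finite A" and odd: "odd (card A)"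
  obtains \<mu> where "\<And>i. i \<in> A \<Longrightarrow> involution_on A (\<mu> i)"
    and "\<And>i x. i \<in> A \<Longrightarrow> x \<in> A \<Longrightarrow> \<mu> i x = x \<longleftrightarrow> x = i"
    and "\<And>x y. x \<in> A \<Longrightarrow> y \<in> A \<Longrightarrow> \<exists>i\<in>A. \<mu> i x = y"
proof -
  define n where "n = int (card A)"
  obtain k where k: "n = 2 * k + 1" using odd by (metis n_def oddE even_of_nat)
  have n: "n > 0" using odd by (auto simp: n_def odd_pos)
  obtain e0 where "bij_betw e0 A {0..<card A}"
    using ex_bij_betw_finite_nat[OF fin] by auto
  moreover have "bij_betw int {0..<card A} {0..<n}"
    unfolding bij_betw_def n_def by (simp add: image_int_atLeastLessThan)
  ultimately have "bij_betw (int \<circ> e0) A {0..<n}" by (rule bij_betw_trans)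
  then obtain e where e: "bij_betw e A {0..<n}" by blast
  define e' where "e' = inv_into A e"
  have e_in: "0 \<le> e x" "e x < n" if "x \<in> A" for x using bij_betwE[OF e] that by auto
  have e'_in: "e' r \<in> A" and ee': "e (e' r) = r" if "0 \<le> r" "r < n" for r
    using bij_betw_inv_into_right[OF e] bij_betwE[OF bij_betw_inv_into[OF e]] that
    by (auto simp: e'_def)
  have e'e: "e' (e x) = x" if "x \<in> A" for x
    using bij_betw_inv_into_left[OF e that] by (simp add: e'_def)
  define \<mu> where "\<mu> i x = e' ((2 * e i - e x) mod n)" for i x
  have \<mu>_in: "\<mu> i x \<in> A" and e\<mu>: "e (\<mu> i x) = (2 * e i - e x) mod n" for i x
    unfolding \<mu>_def using e'_in ee' n by simp_all
  show ?thesis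
  proof
    show "involution_on A (\<mu> i)" if "i \<in> A" for i
      unfolding involution_on_def
    proof safe
      fix x assume x: "x \<in> A"
      show "\<mu> i x \<in> A" by (rule \<mu>_in)
      have "e (\<mu> i (\<mu> i x)) = (2 * e i - (2 * e i - e x)) mod n"
        unfolding e\<mu> by (rule mod_diff_right_eq)
      also have "\<dots> = e x" using e_in[OF x] by simp
      finally show "\<mu> i (\<mu> i x) = x" using e'e \<mu>_in x by metis
    qed
    show "\<mu> i x = x \<longleftrightarrow> x = i" if i: "i \<in> A" and x: "x \<in> A" for i x
    proof
      assume "\<mu> i x = x"
      then have "(2 * e i - e x) mod n = e x mod n" using e\<mu>[of i x] e_in[OF x] by simp
      then have "n dvd 2 * (e i - e x)" by (simp add: mod_eq_dvd_iff algebra_simps)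
      \<comment> \<open>The factor 2 can be cancelled because \<open>n\<close> is odd.\<close>
      moreover have "coprime n 2" using k by simp
      ultimately have "n dvd e i - e x" using coprime_dvd_mult_right_iff by blast
      moreover have "\<bar>e i - e x\<bar> < n" using e_in i x by (smt (verit))
      ultimately have "e i = e x" using zdvd_not_zless[of "\<bar>e i - e x\<bar>" n] by auto
      then show "x = i" using e'e i x by metis
    next
      assume "x = i"
      then show "\<mu> i x = x" using e\<mu>[of i i] e_in[OF i] e'e[OF i] by (simp add: \<mu>_def)
    qed
    show "\<exists>i\<in>A. \<mu> i x = y" if x: "x \<in> A" and y: "y \<in> A" for x y
    proof
      \<comment> \<open>As \<open>2 * (k + 1) = n + 1\<close>, multiplication by
        \<open>k + 1\<close> halves modulo \<open>n\<close>: this is the midpoint of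
        \<open>x\<close> and \<open>y\<close>.\<close>
      define i where "i = e' (((e x + e y) * (k + 1)) mod n)"
      show "i \<in> A" unfolding i_def using e'_in n by simp
      have "e i = ((e x + e y) * (k + 1)) mod n" unfolding i_def using ee' n by simp
      then have "e (\<mu> i x) = (2 * ((e x + e y) * (k + 1)) - e x) mod n"
        unfolding e\<mu> by (metis mod_diff_left_eq mod_mult_right_eq)
      also have "2 * ((e x + e y) * (k + 1)) - e x = e y + n * (e x + e y)"
        by (simp add: k algebra_simps)
      also have "\<dots> mod n = e y" using e_in[OF y] by simp
      finally show "\<mu> i x = y" using e'e \<mu>_in y by metis
    qed
  qed
qed

text \<open>Adding a point to a near-1-factorization and matching it with the unmatched point of each
  class.\<close>

lemma one_factorization:
  assumes fin: "finite A" and even: "even (card A)" and z: "z \<in> A"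
  obtains \<mu> where "\<And>i. i \<in> A - {z} \<Longrightarrow> involution_on A (\<mu> i)"
    and "\<And>i x. i \<in> A - {z} \<Longrightarrow> x \<in> A \<Longrightarrow> \<mu> i x \<noteq> x"
    and "\<And>x y. x \<in> A \<Longrightarrow> y \<in> A \<Longrightarrow> x \<noteq> y \<Longrightarrow> \<exists>i\<in>A - {z}. \<mu> i x = y"
proof -
  have "0 < card A" using fin z by (auto simp: card_gt_0_iff)
  then have card: "odd (card (A - {z}))" using fin z even by auto
  obtain \<nu> where \<nu>: "\<And>i. i \<in> A - {z} \<Longrightarrow> involution_on (A - {z}) (\<nu> i)"
      "\<And>i x. i \<in> A - {z} \<Longrightarrow> x \<in> A - {z} \<Longrightarrow> \<nu> i x = x \<longleftrightarrow> x = i"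
      "\<And>x y. x \<in> A - {z} \<Longrightarrow> y \<in> A - {z} \<Longrightarrow> \<exists>i\<in>A - {z}. \<nu> i x = y"
    by (rule near_one_factorization[OF finite_Diff[OF fin] card]) (rule that; assumption)
  define \<mu> where "\<mu> i x = (if x = z then i else if x = i then z else \<nu> i x)" for i x
  show ?thesis
  proof
    show "involution_on A (\<mu> i)" if i: "i \<in> A - {z}" for i
      unfolding involution_on_def
    proof
      fix x assume x: "x \<in> A"
      show "\<mu> i x \<in> A \<and> \<mu> i (\<mu> i x) = x"
      proof (cases "x = z \<or> x = i")
        case True
        then show ?thesis using i z by (auto simp: \<mu>_def)
      next
        case False
        then have x': "x \<in> A - {z}" "x \<noteq> i" using x by auto
        have "\<nu> i x \<in> A - {z}" "\<nu> i (\<nu> i x) = x"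
          using \<nu>(1)[OF i] x'(1) by (auto simp: involution_on_def)
        moreover have "\<nu> i i = i" using \<nu>(2) i by blast
        ultimately show ?thesis using x' by (auto simp: \<mu>_def)
      qed
    qed
    show "\<mu> i x \<noteq> x" if i: "i \<in> A - {z}" and x: "x \<in> A" for i x
      using i x \<nu>(2)[OF i, of x] by (auto simp: \<mu>_def)
    show "\<exists>i\<in>A - {z}. \<mu> i x = y" if x: "x \<in> A" and y: "y \<in> A" and "x \<noteq> y" for x y
    proof -
      consider "x = z" | "y = z" "x \<noteq> z" | "x \<noteq> z" "y \<noteq> z" by blast
      then show ?thesis
      proof cases
        case 1
        then show ?thesis using y \<open>x \<noteq> y\<close> by (intro bexI[of _ y]) (auto simp: \<mu>_def)
      next
        case 2
        then show ?thesis using x by (intro bexI[of _ x]) (auto simp: \<mu>_def)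
      next
        case 3
        then obtain i where i: "i \<in> A - {z}" "\<nu> i x = y" using \<nu>(3)[of x y] x y by auto
        \<comment> \<open>The fixed point of \<open>\<nu> i\<close> is \<open>i\<close>, so
          \<open>x = i\<close> would give \<open>x = y\<close>.\<close>
        moreover have "x \<noteq> i" using \<nu>(2)[of i x] i x 3 \<open>x \<noteq> y\<close> by auto
        ultimately show ?thesis using 3 by (intro bexI[of _ i]) (auto simp: \<mu>_def)
      qed
    qed
  qed
qed

section \<open>The fibres of a product and the pairing invariant\<close>

locale fibre_game =
  fixes G :: "('a \<times> 'b) pair_pre_digraph" and R :: "'a set" and S :: "'b set"
  assumes verts: "pverts G = R \<times> S" and finite_R: "finite R" and finite_S: "finite S"
    and two_rows: "2 \<le> card R"
begin

abbreviation colours :: nat where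
  "colours \<equiv> card S + 1"

definition full :: "('a \<times> 'b) play \<Rightarrow> 'b \<Rightarrow> bool" where
  "full p f \<longleftrightarrow> R \<times> {f} \<subseteq> fst ` set p"

text \<open>Permuting the rows does not change this sum, so a colour-preserving automorphism that
  splits carries each fibre to one of equal sum. Uncoloured vertices contribute
  \<open>the None\<close>, which is why only full fibres are compared in the invariant.\<close>

definition fibre_sum :: "('a \<times> 'b) play \<Rightarrow> 'b \<Rightarrow> nat" where
  "fibre_sum p f = (\<Sum>h\<in>R. final_coloring p (h, f))"

text \<open>T contains the fibres in which a vertex has been coloured, and \<open>M f\<close> matches the
  vertices of the fibre f; a fixed point of \<open>M f\<close> is the vertex with which f was opened.\<close>

definition matched :: "('b \<Rightarrow> 'a \<Rightarrow> 'a) \<Rightarrow> 'b set \<Rightarrow> ('a \<times> 'b) play \<Rightarrow> bool" where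
  "matched M T p \<longleftrightarrow> legal_play G colours p \<and> T \<subseteq> S \<and> fst ` set p \<subseteq> R \<times> T \<and>
    (\<forall>f\<in>T. involution_on R (M f) \<and>
      (\<forall>h\<in>R. (M f h = h \<longrightarrow> (h, f) \<in> fst ` set p) \<and>
        ((h, f) \<in> fst ` set p \<longrightarrow> (M f h, f) \<in> fst ` set p \<and>
          (M f h \<noteq> h \<longrightarrow> final_coloring p (M f h, f) \<noteq> final_coloring p (h, f))))) \<and>
    inj_on (\<lambda>f. fibre_sum p f mod colours) {f \<in> S. full p f}"

text \<open>Starts both strategies: with \<open>T = S\<close> if the matchings have no fixed points,
  with \<open>T = {}\<close> if they have one each.\<close>

lemma matched_Nil:
  assumes "T \<subseteq> S" and "\<And>f. f \<in> T \<Longrightarrow> involution_on R (M f)"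
    and "\<And>f h. f \<in> T \<Longrightarrow> h \<in> R \<Longrightarrow> M f h \<noteq> h"
  shows "matched M T []"
proof -
  have "\<not> full [] f" for f using two_rows by (auto simp: full_def)
  then show ?thesis using assms by (simp add: matched_def legal_play_def)
qed

text \<open>The opening vertex is the fixed point of the new matching, so the rest of the fibre is
  paired and uncoloured. With two rows or more the fibre is not full yet; hence the colour is
  arbitrary and the sums of full fibres are untouched. This covers openings by either
  player.\<close>

lemma matched_open:
  assumes p: "matched M T p" and f: "f \<in> S" "f \<notin> T" and h: "h \<in> R"
    and k: "k \<in> {1..colours}"
    and \<mu>: "involution_on R \<mu>" "\<And>x. x \<in> R \<Longrightarrow> \<mu> x = x \<longleftrightarrow> x = h"
  shows "matched (M(f := \<mu>)) (insert f T) (p @ [((h, f), k)])"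
proof -
  let ?p = "p @ [((h, f), k)]"
  have sub: "fst ` set p \<subseteq> R \<times> T" using p by (simp add: matched_def)
  then have new: "(x, f) \<notin> fst ` set p" for x using f by auto
  have legal: "legal_play G colours ?p"
    using p f h k new verts by (simp add: matched_def legal_play_snoc)
  have col: "final_coloring ?p v = (if v = (h, f) then k else final_coloring p v)" for v
    using final_coloring_snoc[OF new] .
  obtain h' where h': "h' \<in> R" "h' \<noteq> h"
    using two_rows by (metis card_le_Suc0_iff_eq finite_R h not_less_eq_eq numeral_2_eq_2)
  have "(h', f) \<notin> fst ` set ?p" using h' new by simp
  then have not_full: "\<not> full ?p f" using h' unfolding full_def by blast
  have "full p f' \<longleftrightarrow> full ?p f'" if "f' \<noteq> f" for f'
    using that by (auto simp: full_def)
  with not_full have fulls: "{f' \<in> S. full ?p f'} = {f' \<in> S. full p f'} - {f}"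
    by (intro set_eqI) (metis (mono_tags, lifting) Diff_iff mem_Collect_eq singletonD singletonI)
  have sums: "fibre_sum ?p f' = fibre_sum p f'" if "f' \<noteq> f" for f'
    using that by (simp add: fibre_sum_def col)
  have "inj_on (\<lambda>f'. fibre_sum p f' mod colours) ({f' \<in> S. full p f'} - {f})"
    using p by (auto simp: matched_def intro: inj_on_subset)
  then have inj: "inj_on (\<lambda>f'. fibre_sum ?p f' mod colours) {f' \<in> S. full ?p f'}"
    unfolding fulls by (rule inj_on_cong[THEN iffD1, rotated]) (simp add: sums)
  have pairs: "\<forall>f'\<in>insert f T. involution_on R ((M(f := \<mu>)) f') \<and>
      (\<forall>x\<in>R. ((M(f := \<mu>)) f' x = x \<longrightarrow> (x, f') \<in> fst ` set ?p) \<and>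
        ((x, f') \<in> fst ` set ?p \<longrightarrow> ((M(f := \<mu>)) f' x, f') \<in> fst ` set ?p \<and>
          ((M(f := \<mu>)) f' x \<noteq> x \<longrightarrow>
            final_coloring ?p ((M(f := \<mu>)) f' x, f') \<noteq> final_coloring ?p (x, f'))))"
  proof
    fix f' assume "f' \<in> insert f T"
    then consider "f' = f" | "f' \<in> T" "f' \<noteq> f" using f by auto
    then show "involution_on R ((M(f := \<mu>)) f') \<and>
      (\<forall>x\<in>R. ((M(f := \<mu>)) f' x = x \<longrightarrow> (x, f') \<in> fst ` set ?p) \<and>
        ((x, f') \<in> fst ` set ?p \<longrightarrow> ((M(f := \<mu>)) f' x, f') \<in> fst ` set ?p \<and>
          ((M(f := \<mu>)) f' x \<noteq> x \<longrightarrow>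
            final_coloring ?p ((M(f := \<mu>)) f' x, f') \<noteq> final_coloring ?p (x, f'))))"
    proof cases
      case 1
      then show ?thesis using \<mu> h new by auto
    next
      case 2
      then show ?thesis using p by (auto simp: matched_def col)
    qed
  qed
  have "insert f T \<subseteq> S" "fst ` set ?p \<subseteq> R \<times> insert f T"
    using p sub f h by (auto simp: matched_def)
  then show ?thesis unfolding matched_def using legal pairs inj by blast
qed

text \<open>One colour is forbidden by the partner and at most \<open>card S - 1\<close> by the sums of the other
  fibres.\<close>

lemma colour_ex:
  assumes "f \<in> S"
  obtains k where "k \<in> {1..colours}" and "k \<noteq> k'"
    and "\<And>f'. f' \<in> S \<Longrightarrow> f' \<noteq> f \<Longrightarrow> (k + r) mod colours \<noteq> g f' mod colours"
proof -
  define B where "B = {k \<in> {1..colours}. (k + r) mod colours \<in> (\<lambda>f'. g f' mod colours) ` (S - {f})}"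
  \<comment> \<open>The colours form a complete system of residues, and a shift by \<open>r\<close>
    keeps them distinct.\<close>
  have inj: "inj_on (\<lambda>k. (k + r) mod colours) {1..colours}"
  proof (rule linorder_inj_onI)
    fix x y assume xy: "x < y" "x \<in> {1..colours}" "y \<in> {1..colours}"
    show "(x + r) mod colours \<noteq> (y + r) mod colours"
    proof
      assume "(x + r) mod colours = (y + r) mod colours"
      then have "colours dvd (y + r) - (x + r)"
        using mod_eq_dvd_iff_nat[of "x + r" "y + r" colours] xy(1) by simp
      then have "colours \<le> y - x" using xy(1) by (simp add: dvd_imp_le)
      then show False using xy by auto
    qed
  qed auto
  have "card B \<le> card ((\<lambda>f'. g f' mod colours) ` (S - {f}))"
    using inj finite_S by (intro card_inj_on_le[of "\<lambda>k. (k + r) mod colours"])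
      (auto simp: B_def intro: inj_on_subset)
  also have "\<dots> \<le> card (S - {f})" using finite_S by (intro card_image_le) simp
  also have "\<dots> = card S - 1" using assms finite_S by simp
  finally have "card B \<le> card S - 1" .
  then have "card (insert k' B) \<le> Suc (card S - 1)"
    using card_insert_le_m1 le_trans by (simp add: B_def card_insert_if)
  \<comment> \<open>\<open>S\<close> contains \<open>f\<close>, so \<open>Suc (card S - 1)\<close>
    is \<open>card S\<close>, one less than the number of colours.\<close>
  also have "\<dots> < card {1..colours}"
    using card_gt_0_iff[of S] assms finite_S by auto
  finally have "card (insert k' B) < card {1..colours}" .
  moreover have "finite (insert k' B)" by (simp add: B_def)
  ultimately have "\<not> {1..colours} \<subseteq> insert k' B"
    using card_mono[of "insert k' B" "{1..colours}"] by linarith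
  then obtain k where "k \<in> {1..colours}" "k \<noteq> k'" "k \<notin> B" by blast
  then show ?thesis using that[of k] by (auto simp: B_def)
qed

text \<open>A vertex still free in a touched fibre is no fixed point, as those are coloured, and its
  partner is free too, as the coloured vertices of a fibre are closed under the matching. So Gentle
  can answer at the partner.\<close>

lemma matched_reply:
  assumes p: "matched M T p" and legal: "legal_play G colours (p @ [((h, f), k)])" and f: "f \<in> T"
  shows "\<exists>g. legal_play G colours (p @ [((h, f), k), g]) \<and> matched M T (p @ [((h, f), k), g])"
proof -
  define h' where "h' = M f h"
  have new: "(h, f) \<notin> fst ` set p" and h: "h \<in> R" and fS: "f \<in> S" and k: "k \<in> {1..colours}"
    using legal verts by (auto simp: legal_play_snoc)
  have inv: "involution_on R (M f')"
    and fix_col: "\<And>x. x \<in> R \<Longrightarrow> M f' x = x \<Longrightarrow> (x, f') \<in> fst ` set p"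
    and closed: "\<And>x. x \<in> R \<Longrightarrow> (x, f') \<in> fst ` set p \<Longrightarrow> (M f' x, f') \<in> fst ` set p"
    and differ: "\<And>x. x \<in> R \<Longrightarrow> (x, f') \<in> fst ` set p \<Longrightarrow> M f' x \<noteq> x \<Longrightarrow>
      final_coloring p (M f' x, f') \<noteq> final_coloring p (x, f')" if "f' \<in> T" for f'
    using p that by (auto simp: matched_def)
  have h': "h' \<in> R" "M f h' = h" using inv[OF f] h by (auto simp: h'_def involution_on_def)
  have neq: "h' \<noteq> h" using fix_col[OF f h] new by (auto simp: h'_def)
  have new': "(h', f) \<notin> fst ` set p" using closed[OF f h'(1)] h'(2) new by auto
  \<comment> \<open>The sum of the fibre apart from the colour \<open>k'\<close> still to be chosen.
    That colour avoids the sums of all other fibres, whether or not this fibre becomes full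
    now.\<close>
  define r where "r = k + (\<Sum>x\<in>R - {h, h'}. final_coloring p (x, f))"
  obtain k' where k': "k' \<in> {1..colours}" "k' \<noteq> k"
    "\<And>f'. f' \<in> S \<Longrightarrow> f' \<noteq> f \<Longrightarrow> (k' + r) mod colours \<noteq> fibre_sum p f' mod colours"
    using colour_ex[OF fS] by metis
  let ?q = "p @ [((h, f), k)]"
  let ?p = "?q @ [((h', f), k')]"
  have "(h', f) \<notin> fst ` set ?q" using new' neq by auto
  then have legal': "legal_play G colours ?p"
    and col: "final_coloring ?p v = (if v = (h', f) then k' else if v = (h, f) then k
      else final_coloring p v)" for v
    using legal h' fS k' verts final_coloring_snoc[of "(h', f)" ?q k' v]
      final_coloring_snoc[OF new, of k v]
    by (simp_all add: legal_play_snoc del: append_assoc)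
  have set_p: "fst ` set ?p = fst ` set p \<union> {(h, f), (h', f)}" by auto
  have full: "full ?p f' \<longleftrightarrow> full p f'" if "f' \<noteq> f" for f'
    using that unfolding full_def set_p by auto
  have sums: "fibre_sum ?p f' = fibre_sum p f'" if "f' \<noteq> f" for f'
    using that by (simp add: fibre_sum_def col del: append_assoc)
  have sum_f: "fibre_sum ?p f = k' + r"
  proof -
    have "fibre_sum ?p f = (\<Sum>x\<in>R - {h, h'}. final_coloring ?p (x, f))
        + (\<Sum>x\<in>{h, h'}. final_coloring ?p (x, f))"
      unfolding fibre_sum_def using finite_R h h'(1) by (intro sum.subset_diff) auto
    also have "(\<Sum>x\<in>R - {h, h'}. final_coloring ?p (x, f))
        = (\<Sum>x\<in>R - {h, h'}. final_coloring p (x, f))"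
      by (intro sum.cong) (auto simp: col simp del: append_assoc)
    also have "(\<Sum>x\<in>{h, h'}. final_coloring ?p (x, f)) = k + k'"
      using neq by (simp add: col del: append_assoc)
    finally show ?thesis by (simp add: r_def)
  qed
  have old_inj: "f1 = f2"
    if "fibre_sum p f1 mod colours = fibre_sum p f2 mod colours" "f1 \<in> S" "full p f1" "f2 \<in> S" "full p f2"
    for f1 f2
    using p that by (auto simp: matched_def dest: inj_onD)
  have inj: "inj_on (\<lambda>f'. fibre_sum ?p f' mod colours) {f' \<in> S. full ?p f'}"
  proof (rule inj_onI)
    fix f1 f2 assume f12: "f1 \<in> {f' \<in> S. full ?p f'}" "f2 \<in> {f' \<in> S. full ?p f'}"
      and eq: "fibre_sum ?p f1 mod colours = fibre_sum ?p f2 mod colours"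
    consider "f1 = f" "f2 = f" | "f1 = f" "f2 \<noteq> f" | "f1 \<noteq> f" "f2 = f" | "f1 \<noteq> f" "f2 \<noteq> f"
      by blast
    then show "f1 = f2"
    proof cases
      case 2
      then show ?thesis using eq k'(3)[of f2] sums sum_f f12 by simp
    next
      case 3
      then show ?thesis using eq k'(3)[of f1] sums sum_f f12 by simp
    next
      case 4
      then show ?thesis using eq sums full f12 old_inj by simp
    qed simp
  qed
  have pairs: "\<forall>f'\<in>T. involution_on R (M f') \<and>
      (\<forall>x\<in>R. (M f' x = x \<longrightarrow> (x, f') \<in> fst ` set ?p) \<and>
        ((x, f') \<in> fst ` set ?p \<longrightarrow> (M f' x, f') \<in> fst ` set ?p \<and>
          (M f' x \<noteq> x \<longrightarrow> final_coloring ?p (M f' x, f') \<noteq> final_coloring ?p (x, f'))))"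
  proof (intro ballI conjI impI)
    fix f' x assume f': "f' \<in> T" and x: "x \<in> R"
    show "(x, f') \<in> fst ` set ?p" if "M f' x = x"
      using fix_col[OF f' x that] unfolding set_p by blast
    assume "(x, f') \<in> fst ` set ?p"
    then consider "(x, f') \<in> fst ` set p" | "x = h" "f' = f" | "x = h'" "f' = f"
      unfolding set_p by auto
    then have both: "(M f' x, f') \<in> fst ` set ?p \<and>
        (M f' x \<noteq> x \<longrightarrow> final_coloring ?p (M f' x, f') \<noteq> final_coloring ?p (x, f'))"
    proof cases
      case 1
      then have c: "(M f' x, f') \<in> fst ` set p" using closed[OF f' x] by simp
      then have "final_coloring ?p (M f' x, f') = final_coloring p (M f' x, f')"
        "final_coloring ?p (x, f') = final_coloring p (x, f')"
        using 1 new new' by (auto simp: col simp del: append_assoc)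
      then show ?thesis using c differ[OF f' x 1] unfolding set_p by auto
    next
      case 2
      then show ?thesis using k'(2) neq unfolding set_p col by (auto simp: h'_def)
    next
      case 3
      then show ?thesis using k'(2) neq h' unfolding set_p col by auto
    qed
    then show "(M f' x, f') \<in> fst ` set ?p" ..
    show "final_coloring ?p (M f' x, f') \<noteq> final_coloring ?p (x, f')" if "M f' x \<noteq> x"
      using both that by blast
  qed (rule inv)
  have "T \<subseteq> S" "fst ` set ?p \<subseteq> R \<times> T"
    using p f h h' unfolding set_p by (auto simp: matched_def)
  then have "matched M T ?p" unfolding matched_def using legal' pairs inj by blast
  then show ?thesis using legal' by auto
qed

lemma matched_complete_touched:
  assumes "matched M T p" and "complete_play G colours p"
  shows "T = S"
proof -
  obtain h where "h \<in> R" using two_rows by fastforce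
  have "R \<times> S \<subseteq> R \<times> T" using assms verts by (auto simp: matched_def complete_play_def)
  then show ?thesis using \<open>h \<in> R\<close> assms(1) by (auto simp: matched_def)
qed

text \<open>Distinct sums force \<open>\<beta>\<close> to be the identity. A row \<open>h\<close>
  moved by \<open>\<alpha>\<close> is matched with \<open>\<alpha> h\<close> in some fibre, where
  the two vertices have different colours.\<close>

lemma matched_complete_distinguishing:
  assumes p: "matched M T p" and complete: "complete_play G colours p"
    and cover: "\<And>x y. x \<in> R \<Longrightarrow> y \<in> R \<Longrightarrow> x \<noteq> y \<Longrightarrow> \<exists>f\<in>S. M f x = y"
    and split: "\<And>\<sigma>. automorphism G \<sigma> \<Longrightarrow> \<exists>\<alpha> \<beta>. bij_betw \<alpha> R R \<and> bij_betw \<beta> S S \<and>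
      (\<forall>h\<in>R. \<forall>f\<in>S. \<sigma> (h, f) = (\<alpha> h, \<beta> f))"
  shows "distinguishing G (final_coloring p)"
  unfolding distinguishing_def
proof (intro allI impI ballI)
  fix \<sigma> v
  assume \<sigma>: "automorphism G \<sigma> \<and> (\<forall>v\<in>pverts G. final_coloring p (\<sigma> v) = final_coloring p v)"
    and v: "v \<in> pverts G"
  then obtain \<alpha> \<beta> where \<alpha>: "bij_betw \<alpha> R R" and \<beta>: "bij_betw \<beta> S S"
    and eq: "\<And>h f. h \<in> R \<Longrightarrow> f \<in> S \<Longrightarrow> \<sigma> (h, f) = (\<alpha> h, \<beta> f)"
    using split by metis
  have col: "final_coloring p (\<alpha> h, \<beta> f) = final_coloring p (h, f)" if "h \<in> R" "f \<in> S" for h f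
    using \<sigma> that eq verts by (metis SigmaI)
  have set_p: "fst ` set p = R \<times> S" using complete verts by (simp add: complete_play_def)
  have \<beta>_id: "\<beta> f = f" if f: "f \<in> S" for f
  proof -
    have \<beta>f: "\<beta> f \<in> S" using bij_betwE[OF \<beta>] f by auto
    have "fibre_sum p (\<beta> f) = (\<Sum>h\<in>R. final_coloring p (\<alpha> h, \<beta> f))"
      unfolding fibre_sum_def by (rule sum.reindex_bij_betw[OF \<alpha>, symmetric])
    also have "\<dots> = fibre_sum p f"
      unfolding fibre_sum_def using col f by (intro sum.cong) auto
    finally have "fibre_sum p (\<beta> f) = fibre_sum p f" .
    moreover have "full p f'" if "f' \<in> S" for f' using that set_p by (auto simp: full_def)
    moreover have "inj_on (\<lambda>f. fibre_sum p f mod colours) {f \<in> S. full p f}"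
      using p by (simp add: matched_def)
    ultimately show ?thesis using f \<beta>f by (simp add: inj_on_def)
  qed
  have \<alpha>_id: "\<alpha> h = h" if h: "h \<in> R" for h
  proof (rule ccontr)
    assume neq: "\<alpha> h \<noteq> h"
    have "\<alpha> h \<in> R" using bij_betwE[OF \<alpha>] h by auto
    then obtain f where f: "f \<in> S" "M f h = \<alpha> h" using cover h neq by metis
    have "T = S" using matched_complete_touched[OF p complete] .
    with p have "\<forall>f\<in>S. \<forall>h\<in>R. (h, f) \<in> fst ` set p \<longrightarrow> M f h \<noteq> h \<longrightarrow>
        final_coloring p (M f h, f) \<noteq> final_coloring p (h, f)"
      by (simp add: matched_def)
    from this[rule_format, OF f(1) h] have "final_coloring p (M f h, f) \<noteq> final_coloring p (h, f)"
      using f h neq set_p by simp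
    then show False using col[OF h f(1)] \<beta>_id[OF f(1)] f(2) by simp
  qed
  show "\<sigma> v = v" using v verts eq \<alpha>_id \<beta>_id by auto
qed

end

section \<open>The winning strategies for even and odd numbers of rows\<close>

locale rigid_fibre_game = fibre_game +
  assumes automorphism_split: "automorphism G \<sigma> \<Longrightarrow> \<exists>\<alpha> \<beta>. bij_betw \<alpha> R R \<and> bij_betw \<beta> S S \<and>
      (\<forall>h\<in>R. \<forall>f\<in>S. \<sigma> (h, f) = (\<alpha> h, \<beta> f))"
begin

text \<open>All fibres count as touched from the beginning, so Gentle always answers in the fibre of
  Rascal's move. The bound on \<open>card S\<close> leaves a fibre for each of the
  \<open>card R - 1\<close> matchings of a 1-factorization.\<close>

lemma winning_even_rows:
  assumes even: "even (card R)" and large: "card R - 1 \<le> card S"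
  shows "gentle_has_winning_strategy Rascal G colours"
proof -
  obtain z where z: "z \<in> R" using two_rows by fastforce
  obtain \<mu> where \<mu>: "\<And>i. i \<in> R - {z} \<Longrightarrow> involution_on R (\<mu> i)"
      "\<And>i x. i \<in> R - {z} \<Longrightarrow> x \<in> R \<Longrightarrow> \<mu> i x \<noteq> x"
      "\<And>x y. x \<in> R \<Longrightarrow> y \<in> R \<Longrightarrow> x \<noteq> y \<Longrightarrow> \<exists>i\<in>R - {z}. \<mu> i x = y"
    by (rule one_factorization[OF finite_R even z]) (rule that; assumption)
  have card: "card (R - {z}) = card R - 1" using z finite_R by simp
  then have le: "card (R - {z}) \<le> card S"
    using large by simp
  have "0 < card (R - {z})" using card two_rows by simp
  then have ne: "R - {z} \<noteq> {}" by (metis card_gt_0_iff)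
  then obtain e where e: "e ` (R - {z}) \<subseteq> S" "inj_on e (R - {z})"
    using card_le_inj[OF _ finite_S le] finite_R by auto
  obtain i0 where i0: "i0 \<in> R - {z}" using ne by auto
  \<comment> \<open>Fibre \<open>e i\<close> gets class \<open>i\<close>; the fibres outside the
    range of \<open>e\<close> get the arbitrary class \<open>i0\<close>.\<close>
  define \<phi> where "\<phi> f = (if f \<in> e ` (R - {z}) then inv_into (R - {z}) e f else i0)" for f
  have \<phi>: "\<phi> f \<in> R - {z}" for f
    unfolding \<phi>_def using i0 inv_into_into[of f e "R - {z}"] by auto
  have \<phi>_e: "\<phi> (e i) = i" if "i \<in> R - {z}" for i
    using that e(2) by (simp add: \<phi>_def)
  define M where "M f = \<mu> (\<phi> f)" for f
  show ?thesis
  proof (rule winning_strategy_by_invariant[where I = "matched M S"])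
    show "1 \<le> colours" by simp
    show "matched M S []"
      using matched_Nil \<mu> \<phi> by (simp add: M_def)
    show "\<exists>g. legal_play G colours (p @ [r, g]) \<and> matched M S (p @ [r, g])"
      if p: "matched M S p" and r: "legal_play G colours (p @ [r])" for p r
    proof -
      obtain h f k where [simp]: "r = ((h, f), k)" by (metis prod.exhaust)
      have "f \<in> S" using r verts by (auto simp: legal_play_snoc)
      then show ?thesis using matched_reply[OF p] r by simp
    qed
    show "distinguishing G (final_coloring p)"
      if "matched M S p" "complete_play G colours p" for p
    proof (rule matched_complete_distinguishing[OF that _ automorphism_split])
      fix x y assume "x \<in> R" "y \<in> R" "x \<noteq> y"
      then obtain i where i: "i \<in> R - {z}" "\<mu> i x = y" using \<mu>(3) by metis
      then show "\<exists>f\<in>S. M f x = y"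
        using e(1) \<phi>_e by (intro bexI[of _ "e i"]) (auto simp: M_def)
    qed
  qed simp
qed

text \<open>After each move of Gentle the number of untouched fibres is even, so that she can answer
  the opening of a fibre by opening another one, at a row with which no fibre has been opened
  yet. The row \<open>\<phi> f\<close> is the one with which the fibre f was opened.\<close>

lemma winning_odd_rows:
  assumes odd: "odd (card R)"
    and large: "first = Rascal \<Longrightarrow> even (card S) \<and> 2 * card R - 2 \<le> card S"
      "first = Gentle \<Longrightarrow> odd (card S) \<and> 2 * card R - 1 \<le> card S"
  shows "gentle_has_winning_strategy first G colours"
proof -
  obtain \<mu> where \<mu>: "\<And>i. i \<in> R \<Longrightarrow> involution_on R (\<mu> i)"
      "\<And>i x. i \<in> R \<Longrightarrow> x \<in> R \<Longrightarrow> \<mu> i x = x \<longleftrightarrow> x = i"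
      "\<And>x y. x \<in> R \<Longrightarrow> y \<in> R \<Longrightarrow> \<exists>i\<in>R. \<mu> i x = y"
    by (rule near_one_factorization[OF finite_R odd]) (rule that; assumption)
  obtain h0 where h0: "h0 \<in> R" using two_rows by fastforce
  \<comment> \<open>Rows already used, plus one for each pair of untouched fibres, must reach
    \<open>card R\<close>. While \<open>T\<close> is empty one more is available, since Rascal's
    first opening also supplies a new row. Hence \<open>2 * card R - 2\<close> if Rascal begins; if
    Gentle begins, her move uses one fibre and one row, hence \<open>2 * card R - 1\<close>.\<close>
  define I where "I p \<longleftrightarrow> (\<exists>\<phi> T. matched (\<lambda>f. \<mu> (\<phi> f)) T p \<and> \<phi> ` T \<subseteq> R \<and> even (card (S - T)) \<and>
    card R \<le> card (\<phi> ` T) + card (S - T) div 2 + (if T = {} then 1 else 0))" for p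
  have open_row: "matched (\<lambda>f'. \<mu> ((\<phi>(f := h)) f')) (insert f T) (p @ [((h, f), k)])"
    if "matched (\<lambda>f. \<mu> (\<phi> f)) T p" "f \<in> S" "f \<notin> T" "h \<in> R" "k \<in> {1..colours}" for \<phi> T p f h k
  proof -
    have "(\<lambda>f'. \<mu> ((\<phi>(f := h)) f')) = (\<lambda>f. \<mu> (\<phi> f))(f := \<mu> h)" by auto
    then show ?thesis using matched_open[OF that \<mu>(1)[OF that(4)] \<mu>(2)[OF that(4)]] by simp
  qed
  have start: "matched (\<lambda>f. \<mu> (\<phi> f)) {} []" for \<phi> by (rule matched_Nil) auto
  show ?thesis
  proof (rule winning_strategy_by_invariant[where I = I])
    show "1 \<le> colours" by simp
    show "I []" if "first = Rascal"
      unfolding I_def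
      by (rule exI[of _ "\<lambda>_. h0"], rule exI[of _ "{}"]) (use start large(1)[OF that] in auto)
    show "\<exists>x. legal_play G colours [x] \<and> I [x]" if "first = Gentle"
    proof -
      have m: "odd (card S)" "2 * card R - 1 \<le> card S" using large(2)[OF that] by auto
      then obtain f where f: "f \<in> S" by fastforce
      have p: "matched (\<lambda>f'. \<mu> (((\<lambda>_. h0)(f := h0)) f')) (insert f {}) ([] @ [((h0, f), 1)])"
        by (rule open_row[OF start f]) (use h0 in auto)
      have "card (S - {f}) = card S - 1" using f finite_S by simp
      then have "I [((h0, f), 1)]"
        unfolding I_def using p m h0
        by (intro exI[of _ "(\<lambda>_. h0)(f := h0)"] exI[of _ "{f}"]) auto
      then show ?thesis using p by (auto simp: matched_def)
    qed
    show "\<exists>g. legal_play G colours (p @ [r, g]) \<and> I (p @ [r, g])"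
      if "I p" and r: "legal_play G colours (p @ [r])" for p r
    proof -
      from \<open>I p\<close> obtain \<phi> T where p: "matched (\<lambda>f. \<mu> (\<phi> f)) T p" and \<phi>: "\<phi> ` T \<subseteq> R"
        and ev: "even (card (S - T))"
        and count: "card R \<le> card (\<phi> ` T) + card (S - T) div 2 + (if T = {} then 1 else 0)"
        by (auto simp: I_def)
      obtain h f k where r_eq: "r = ((h, f), k)" by (metis prod.exhaust)
      have h: "h \<in> R" and f: "f \<in> S" and k: "k \<in> {1..colours}"
        using r verts by (auto simp: legal_play_snoc r_eq)
      have T: "T \<subseteq> S" "finite T" using p finite_S by (auto simp: matched_def intro: finite_subset)
      show ?thesis
      proof (cases "f \<in> T")
        case True
        then show ?thesis
          using matched_reply[OF p] r \<phi> ev count unfolding I_def r_eq by blast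
      next
        case False
        \<comment> \<open>The untouched fibres are even in number and include \<open>f\<close>, so
          another one is left for Gentle.\<close>
        have "card (S - T) \<noteq> 1" using ev by auto
        then have "S - T \<noteq> {f}" by auto
        then obtain f2 where f2: "f2 \<in> S" "f2 \<notin> T" "f2 \<noteq> f" using f False by auto
        define U where "U = insert h (\<phi> ` T)"
        have U: "U \<subseteq> R" "finite U" using h \<phi> T by (auto simp: U_def)
        obtain h2 where h2: "h2 \<in> R" "h2 \<notin> U \<or> U = R" using U h0 by blast
        define \<phi>' where "\<phi>' = \<phi>(f := h, f2 := h2)"
        define T' where "T' = insert f2 (insert f T)"
        have "matched (\<lambda>f'. \<mu> (\<phi>' f')) T' ((p @ [((h, f), k)]) @ [((h2, f2), 1)])"
          unfolding \<phi>'_def T'_def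
          by (rule open_row[OF open_row[OF p f False h k]]) (use f2 h2 in auto)
        then have p': "matched (\<lambda>f'. \<mu> (\<phi>' f')) T' (p @ [r, ((h2, f2), 1)])"
          by (simp add: r_eq)
        have img: "\<phi>' ` T' = insert h2 U"
          using False f2 by (auto simp: \<phi>'_def T'_def U_def)
        have "S - T' = S - T - {f, f2}" by (auto simp: T'_def)
        moreover have "card {f, f2} = 2" using f2 by simp
        moreover have "{f, f2} \<subseteq> S - T" using f f2 False by auto
        ultimately have card': "card (S - T') + 2 = card (S - T)"
          using finite_S card_mono[of "S - T" "{f, f2}"] by (simp add: card_Diff_subset)
        have "card R \<le> card (insert h2 U) + card (S - T') div 2"
        proof (cases "h2 \<in> U")
          case True
          then show ?thesis using h2 by (simp add: insert_absorb)
        next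
          case notin: False
          \<comment> \<open>If no fibre was touched before, Rascal's row \<open>h\<close> is the
            additional one allowed for in the invariant. In any case the new row \<open>h2\<close>
            makes up for the pair of fibres consumed.\<close>
          have "card (\<phi> ` T) + (if T = {} then 1 else 0) \<le> card U"
            unfolding U_def using T(2) by (auto intro: card_mono)
          then show ?thesis using notin U count card' by simp
        qed
        moreover have "even (card (S - T'))" using ev card' by presburger
        moreover have "\<phi>' ` T' \<subseteq> R" "T' \<noteq> {}"
          using U h2 unfolding img by (auto simp: T'_def)
        ultimately have "I (p @ [r, ((h2, f2), 1)])"
          unfolding I_def using p' img by (intro exI[of _ \<phi>'] exI[of _ T']) simp
        then show ?thesis using p' by (auto simp: matched_def)
      qed
    qed
    show "distinguishing G (final_coloring p)" if "I p" and complete: "complete_play G colours p" for p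
    proof -
      from \<open>I p\<close> obtain \<phi> T where p: "matched (\<lambda>f. \<mu> (\<phi> f)) T p" and \<phi>: "\<phi> ` T \<subseteq> R"
        and count: "card R \<le> card (\<phi> ` T) + card (S - T) div 2 + (if T = {} then 1 else 0)"
        by (auto simp: I_def)
      have T: "T = S" using matched_complete_touched[OF p complete] .
      \<comment> \<open>This removes the additional 1 from \<open>count\<close>; with no untouched
        fibre left, the opening rows then exhaust \<open>R\<close>.\<close>
      have "S \<noteq> {}" using large two_rows by (cases first) auto
      then have "\<phi> ` S = R" using card_seteq[OF finite_R \<phi>] count T by simp
      show ?thesis
      proof (rule matched_complete_distinguishing[OF p complete _ automorphism_split])
        fix x y assume "x \<in> R" "y \<in> R" "x \<noteq> y"
        then obtain i where "i \<in> R" "\<mu> i x = y" using \<mu>(3) by metis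
        then show "\<exists>f\<in>S. \<mu> (\<phi> f) x = y" using \<open>\<phi> ` S = R\<close> by auto
      qed
    qed
  qed
qed

end

section \<open>The three bounds\<close>

theorem theorem1p4:
  fixes H :: "'a pair_pre_digraph" and F :: "'b pair_pre_digraph" and n m :: nat
  assumes "pair_graph H" and "pair_graph F"
    and "nontrivial H" and "nontrivial F"
    and "connected (with_proj H)" and "connected (with_proj F)"
    and "relatively_prime H F"
    and "card (pverts H) = n" and "card (pverts F) = m"
  shows "(even n \<and> m \<ge> n - 1 \<longrightarrow> D_R (H \<box> F) \<le> enat (m + 1)) \<and>
    (odd n \<and> even m \<and> m \<ge> 2 * n - 2 \<longrightarrow> D_R (H \<box> F) \<le> enat (m + 1)) \<and>
    (odd n \<and> odd m \<and> m \<ge> 2 * n - 1 \<longrightarrow> D_G (H \<box> F) \<le> enat (m + 1))"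
proof -
  have graph: "pair_graph H" "connected (with_proj H)" "pair_graph F" "connected (with_proj F)"
    by fact+
  interpret rigid_fibre_game "H \<box> F" "pverts H" "pverts F"
  proof
    show "pverts (H \<box> F) = pverts H \<times> pverts F" by (simp add: cartesian_product_def)
    show "finite (pverts H)" "finite (pverts F)" using graph pair_graph_finite by auto
    show "2 \<le> card (pverts H)" using \<open>nontrivial H\<close> by (simp add: nontrivial_def)
    \<comment> \<open>Connectedness and coprimality enter the game only through this
      splitting.\<close>
    fix \<sigma> assume "automorphism (H \<box> F) \<sigma>"
    from automorphism_relatively_prime_product[OF graph \<open>relatively_prime H F\<close> this]
    show "\<exists>\<alpha> \<beta>. bij_betw \<alpha> (pverts H) (pverts H) \<and> bij_betw \<beta> (pverts F) (pverts F) \<and>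
      (\<forall>h\<in>pverts H. \<forall>f\<in>pverts F. \<sigma> (h, f) = (\<alpha> h, \<beta> f))" by metis
  qed
  note card = \<open>card (pverts H) = n\<close> \<open>card (pverts F) = m\<close>
  have "D_R (H \<box> F) \<le> enat (m + 1)" if "even n" "m \<ge> n - 1"
    using game_distinguishing_number_le[OF _ winning_even_rows] that by (simp add: card)
  moreover have "D_R (H \<box> F) \<le> enat (m + 1)" if "odd n" "even m" "m \<ge> 2 * n - 2"
    using game_distinguishing_number_le[OF _ winning_odd_rows[of Rascal]] that by (simp add: card)
  moreover have "D_G (H \<box> F) \<le> enat (m + 1)" if "odd n" "odd m" "m \<ge> 2 * n - 1"
    using game_distinguishing_number_le[OF _ winning_odd_rows[of Gentle]] that by (simp add: card)
  ultimately show ?thesis by blast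
qed

end
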